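(* Let $n=2$ and consider the mixed-integer convex problem $\min\{f(\hat x,y):(\hat x,y)\in S\cap(\mathbb{Z}^2\times\mathbb{R}^d)\}$ in the setting described in the context. Let $\gamma>0$ and suppose that we can determine, for every $x\in\mathbb{R}^2$ with $g(x)\le 0$, a point $y_x\in\mathbb{R}^d$ with $(x,y_x)\in S$ satisfying $$f(x,y_x)-\gamma\le\min\{f(x,y):(x,y)\in S\}$$ (the minimum being over $y$, with $x$ fixed). Then one can implement the improvement oracle $\mathrm{O}_{0,\kappa\gamma}$ such that for every query point $(x,y)\in S$ it takes a number of evaluations of $f$ that is polynomial in $\ln(V_f/\gamma)$.
   Context: Setting. $f:\mathbb{R}^{n+d}\to\mathbb{R}_+\cup\{+\infty\}$ is a nonnegative proper convex function, Lipschitz continuous on $S:=\{(x,y)\in\mathbb{R}^{n+d}:g_i(x,y)\le 0\text{ for }1\le i\le m\}$, where $g_1,\dots,g_m:\mathbb{R}^{n+d}\to\mathbb{R}$ are differentiable convex functions. The optimization takes place with $S\subseteq[-B,B]^n\times\mathbb{R}^d$ for a known $B\in\mathbb{N}$. Define $g:\mathbb{R}^n\to\mathbb{R}$, $g(x):=\min_{y\in\mathbb{R}^d}\max_{1\le i\le m}g_i(x,y)$; it is assumed that this minimum over $y$ is attained for every $x$, so that $g$ is convex. Define $\phi:\mathbb{R}^n\to\mathbb{R}\cup\{+\infty\}$, $\phi(x):=\min\{f(x,y):(x,y)\in S\}$ (minimum over $y$); $\phi$ is assumed to be convex. It is assumed that $f$ has finite spread $\max\{f(x,y)-f(x',y'):(x,y),(x',y')\in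 S\}$ on $S$, and $V_f$ is a known upper bound on this spread. It is also assumed that the roots of $g$ restricted to a given segment can be computed exactly. Constant: $\kappa:=2/\lambda_0$ with $\lambda_0:=1-\tfrac12(\sqrt5-1)=\tfrac12(3-\sqrt5)$, so $\kappa\approx5.236$. Improvement oracle. For $\alpha,\delta\ge0$, the oracle $\mathrm{O}_{\alpha,\delta}$, queried at $z\in S$, (a) returns a point $\hat z\in S\cap(\mathbb{Z}^n\times\mathbb{R}^d)$ such that $f(\hat z)\le(1+\alpha)f(z)+\delta$, and/or (b) asserts correctly that there is no point $\hat z\in S\cap(\mathbb{Z}^n\times\mathbb{R}^d)$ with $f(\hat z)\le f(z)$. *)

theory Defs
  imports "HOL-Analysis.Analysis" "HOL-Computational_Algebra.Polynomial"
begin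

definition ereal_convex :: "('a::real_vector \<Rightarrow> ereal) \<Rightarrow> bool" where
  "ereal_convex F \<longleftrightarrow>
     (\<forall>x y. \<forall>u\<ge>0. \<forall>v\<ge>0. u + v = 1 \<longrightarrow>
        F (u *\<^sub>R x + v *\<^sub>R y) \<le> ereal u * F x + ereal v * F y)"

definition feasible_set :: "(nat \<Rightarrow> 'x \<times> 'y \<Rightarrow> real) \<Rightarrow> nat \<Rightarrow> ('x \<times> 'y) set" where
  "feasible_set gs m = {z. \<forall>i\<in>{1..m}. gs i z \<le> 0}"

definition max_constraint :: "(nat \<Rightarrow> 'x \<times> 'y \<Rightarrow> real) \<Rightarrow> nat \<Rightarrow> 'x \<times> 'y \<Rightarrow> real" where
  "max_constraint gs m z = Max ((\<lambda>i. gs i z) ` {1..m})"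

text \<open>The two infima below are used only where they are attained, that is, as minima
  (see \<open>min_g_attained\<close> and \<open>min_phi_attained\<close>). The value of \<open>phi\<close> on an empty fibre is \<open>\<infinity>\<close>.\<close>

definition g_min :: "(nat \<Rightarrow> 'x \<times> 'y \<Rightarrow> real) \<Rightarrow> nat \<Rightarrow> 'x \<Rightarrow> real" where
  "g_min gs m x = (INF y. max_constraint gs m (x, y))"

definition phi :: "('x \<times> 'y \<Rightarrow> ereal) \<Rightarrow> ('x \<times> 'y) set \<Rightarrow> 'x \<Rightarrow> ereal" where
  "phi f S x = (INF y \<in> {y. (x, y) \<in> S}. f (x, y))"

definition mixed_integer_points :: "((real ^ 'n) \<times> 'y) set" where
  "mixed_integer_points = {(x, y). \<forall>i. x $ i \<in> \<int>}"

locale mixed_integer_setting =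
  fixes f :: "(real ^ 'n) \<times> (real ^ 'd) \<Rightarrow> ereal"
    and gs :: "nat \<Rightarrow> (real ^ 'n) \<times> (real ^ 'd) \<Rightarrow> real"
    and m B :: nat
    and V :: real
  assumes f_nonneg: "\<And>z. 0 \<le> f z"
    and f_proper: "\<exists>z. f z < \<infinity>"
    and f_convex: "ereal_convex f"
    and f_finite: "\<And>z. z \<in> feasible_set gs m \<Longrightarrow> f z < \<infinity>"
    and f_lipschitz: "\<exists>L. L-lipschitz_on (feasible_set gs m) (\<lambda>z. real_of_ereal (f z))"
    and m_pos: "1 \<le> m"
    and gs_convex: "\<And>i. i \<in> {1..m} \<Longrightarrow> convex_on UNIV (gs i)"
    and gs_differentiable: "\<And>i z. i \<in> {1..m} \<Longrightarrow> gs i differentiable (at z)"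
    and box: "\<And>x y i. (x, y) \<in> feasible_set gs m \<Longrightarrow> \<bar>x $ i\<bar> \<le> real B"
    and min_g_attained:
      "\<And>x. \<exists>y. \<forall>y'. max_constraint gs m (x, y) \<le> max_constraint gs m (x, y')"
    and min_phi_attained:
      "\<And>x. g_min gs m x \<le> 0 \<Longrightarrow>
         \<exists>y. (x, y) \<in> feasible_set gs m \<and> f (x, y) = phi f (feasible_set gs m) x"
    and phi_convex: "ereal_convex (phi f (feasible_set gs m))"
    and spread_bound:
      "\<And>z z'. z \<in> feasible_set gs m \<Longrightarrow> z' \<in> feasible_set gs m \<Longrightarrow> f z - f z' \<le> ereal V"

definition approx_fibre_minimizer ::
  "('x \<times> 'y \<Rightarrow> ereal) \<Rightarrow> (nat \<Rightarrow> 'x \<times> 'y \<Rightarrow> real) \<Rightarrow> nat \<Rightarrow> real \<Rightarrow> ('x \<Rightarrow> 'y) \<Rightarrow> bool" where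
  "approx_fibre_minimizer f gs m \<gamma> ysel \<longleftrightarrow>
     (\<forall>x. g_min gs m x \<le> 0 \<longrightarrow>
        (x, ysel x) \<in> feasible_set gs m \<and>
        f (x, ysel x) - ereal \<gamma> \<le> phi f (feasible_set gs m) x)"

text \<open>A deterministic adaptive procedure is a well-founded decision tree, so every run is finite.
  It learns about the instance only through the answers to its queries: values of \<open>f\<close>,
  the point \<open>y\<^sub>x\<close> belonging to a given \<open>x\<close>, values of \<open>g\<close>, and the exact root set of \<open>g\<close> on a
  segment. Cost is the number of evaluations of \<open>f\<close> on the branch that is actually followed.
  In \<open>Answer r b\<close>, \<open>r\<close> is the point returned, if any, and \<open>b\<close> tells whether the procedure asserts
  that no mixed-integer point is at least as good as the query point.\<close>

datatype ('x, 'y) procedure =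
    Answer "('x \<times> 'y) option" bool
  | Eval_f "'x \<times> 'y" "ereal \<Rightarrow> ('x, 'y) procedure"
  | Ask_y 'x "'y \<Rightarrow> ('x, 'y) procedure"
  | Eval_g 'x "real \<Rightarrow> ('x, 'y) procedure"
  | Roots_g 'x 'x "'x set \<Rightarrow> ('x, 'y) procedure"

primrec outcome ::
  "('x::real_vector \<times> 'y \<Rightarrow> ereal) \<Rightarrow> ('x \<Rightarrow> real) \<Rightarrow> ('x \<Rightarrow> 'y) \<Rightarrow> ('x, 'y) procedure
     \<Rightarrow> ('x \<times> 'y) option \<times> bool" where
  "outcome f g ysel (Answer r b) = (r, b)"
| "outcome f g ysel (Eval_f z k) = outcome f g ysel (k (f z))"
| "outcome f g ysel (Ask_y x k) = outcome f g ysel (k (ysel x))"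
| "outcome f g ysel (Eval_g x k) = outcome f g ysel (k (g x))"
| "outcome f g ysel (Roots_g a b k) = outcome f g ysel (k {x \<in> closed_segment a b. g x = 0})"

primrec f_evaluations ::
  "('x::real_vector \<times> 'y \<Rightarrow> ereal) \<Rightarrow> ('x \<Rightarrow> real) \<Rightarrow> ('x \<Rightarrow> 'y) \<Rightarrow> ('x, 'y) procedure
     \<Rightarrow> nat" where
  "f_evaluations f g ysel (Answer r b) = 0"
| "f_evaluations f g ysel (Eval_f z k) = Suc (f_evaluations f g ysel (k (f z)))"
| "f_evaluations f g ysel (Ask_y x k) = f_evaluations f g ysel (k (ysel x))"
| "f_evaluations f g ysel (Eval_g x k) = f_evaluations f g ysel (k (g x))"
| "f_evaluations f g ysel (Roots_g a b k) =
     f_evaluations f g ysel (k {x \<in> closed_segment a b. g x = 0})"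

text \<open>Admissible answers of the improvement oracle with parameters \<open>\<alpha>, \<delta> \<ge> 0\<close> at the query
  point \<open>z\<close>: at least one of the two alternatives is given, and whatever is given is correct.\<close>

definition improvement_answer ::
  "((real ^ 'n) \<times> 'y \<Rightarrow> ereal) \<Rightarrow> ((real ^ 'n) \<times> 'y) set \<Rightarrow> real \<Rightarrow> real \<Rightarrow> (real ^ 'n) \<times> 'y
     \<Rightarrow> ((real ^ 'n) \<times> 'y) option \<times> bool \<Rightarrow> bool" where
  "improvement_answer f S \<alpha> \<delta> z ans \<longleftrightarrow>
     (fst ans \<noteq> None \<or> snd ans) \<and>
     (\<forall>z'. fst ans = Some z' \<longrightarrow>
        z' \<in> S \<inter> mixed_integer_points \<and> f z' \<le> ereal (1 + \<alpha>) * f z + ereal \<delta>) \<and>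
     (snd ans \<longrightarrow> \<not> (\<exists>z' \<in> S \<inter> mixed_integer_points. f z' \<le> f z))"

definition lambda0 :: real where
  "lambda0 = 1 - (sqrt 5 - 1) / 2"

definition kappa :: real where
  "kappa = 2 / lambda0"

end

theory Submission
  imports Defs
begin

text \<open>The values of \<open>g\<close> at the integer points of the box are free, so the finite set \<open>P\<close> of
  integer points over which \<open>S\<close> is nonempty is known. With \<open>t\<close> the value of \<open>f\<close> at the query
  point, the search maintains a triangle \<open>T\<close> in the convex hull of \<open>P\<close> on which \<open>\<phi> \<le> t + \<theta>\<close> such
  that every candidate \<open>q\<close> (a point of \<open>P\<close> with \<open>\<phi> q \<le> t\<close>) has affine coordinates at most \<open>2\<close> in
  absolute value with respect to \<open>T\<close>. By convexity \<open>\<phi> \<le> t + \<theta> / 2\<close> on every shrunken copy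
  \<open>(1 - l) q + l T\<close> with \<open>l \<le> 1 / 2\<close>. Hence a fixed grid in the coordinates of \<open>T\<close> detects these
  copies, and a grid triangle of largest area among the grid points of measured level at most
  \<open>\<theta> / 2 + \<gamma>\<close> can replace \<open>T\<close>. About \<open>log\<^sub>2 (V / \<gamma>)\<close> rounds, each of constant cost, bring the
  level down to \<open>3 \<gamma>\<close>. Then either \<open>T\<close> contains an integer point, which may be returned, or \<open>T\<close>
  is flat in some integer direction and boundedly many lattice lines contain all candidates. Each
  of these lines is searched in the same way, after thickening it to a strip.\<close>

section \<open>Level descent on triangles\<close>

type_synonym point = "real \<times> real"

definition cross :: "point \<Rightarrow> point \<Rightarrow> real" where
  "cross p q = fst p * snd q - snd p * fst q"

lemma cross_simps:
  "cross (p + q) r = cross p r + cross q r" "cross r (p + q) = cross r p + cross r q"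
  "cross (p - q) r = cross p r - cross q r" "cross r (p - q) = cross r p - cross r q"
  "cross (x *\<^sub>R p) r = x * cross p r" "cross r (x *\<^sub>R p) = x * cross r p"
  "cross p p = 0"
  by (simp_all add: cross_def algebra_simps)

lemma cross_commute: "cross p q = - cross q p"
  by (simp add: cross_def)

text \<open>Cramer's rule. It allows coordinate bounds to be written as bounds on cross products,
  without division.\<close>

lemma cross_coords:
  assumes "cross u w \<noteq> 0"
  shows "p = (cross p w / cross u w) *\<^sub>R u + (cross u p / cross u w) *\<^sub>R w"
proof (rule prod_eqI)
  show "fst p = fst ((cross p w / cross u w) *\<^sub>R u + (cross u p / cross u w) *\<^sub>R w)"
    using assms by (simp add: field_simps) (simp add: cross_def algebra_simps)
  show "snd p = snd ((cross p w / cross u w) *\<^sub>R u + (cross u p / cross u w) *\<^sub>R w)"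
    using assms by (simp add: field_simps) (simp add: cross_def algebra_simps)
qed

section \<open>Triangles of largest area in a finite set\<close>

type_synonym triangle = "point \<times> point \<times> point"

fun area2 :: "triangle \<Rightarrow> real" where
  "area2 (a, b, c) = \<bar>cross (b - a) (c - a)\<bar>"

text \<open>\<open>None\<close> signals that the points of \<open>A\<close> span no triangle at all,
  a case on which the procedures branch.\<close>

definition largest_triangle :: "point set \<Rightarrow> triangle option" where
  "largest_triangle A =
     (if \<exists>T\<in>A \<times> A \<times> A. area2 T > 0
      then Some (SOME T. T \<in> A \<times> A \<times> A \<and> (\<forall>T'\<in>A \<times> A \<times> A. area2 T' \<le> area2 T))
      else None)"

lemma largest_triangle_None:
  "largest_triangle A = None \<Longrightarrow> a \<in> A \<Longrightarrow> b \<in> A \<Longrightarrow> c \<in> A \<Longrightarrow> cross (b - a) (c - a) = 0"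
  unfolding largest_triangle_def by (force split: if_splits)

lemma largest_triangle_Some:
  assumes "finite A" "largest_triangle A = Some T"
  shows "T \<in> A \<times> A \<times> A" "area2 T > 0" "T' \<in> A \<times> A \<times> A \<Longrightarrow> area2 T' \<le> area2 T"
proof -
  let ?X = "A \<times> A \<times> A"
  obtain T0 where T0: "T0 \<in> ?X" "area2 T0 > 0"
    using assms(2) unfolding largest_triangle_def by (auto split: if_splits)
  have "finite ?X" using assms(1) by simp
  have "\<exists>T. T \<in> ?X \<and> (\<forall>T'\<in>?X. area2 T' \<le> area2 T)"
  proof -
    have "Max (area2 ` ?X) \<in> area2 ` ?X"
      using \<open>finite ?X\<close> T0 by (intro Max_in) auto
    then obtain T where "T \<in> ?X" "Max (area2 ` ?X) = area2 T" by blast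
    then show ?thesis using \<open>finite ?X\<close> by (metis Max_ge finite_imageI imageI)
  qed
  from someI_ex[OF this] assms(2)
  have *: "T \<in> ?X \<and> (\<forall>T'\<in>?X. area2 T' \<le> area2 T)"
    unfolding largest_triangle_def by (auto split: if_splits)
  show "T \<in> ?X" using * by blast
  show "area2 T > 0" using * T0 by force
  show "T' \<in> ?X \<Longrightarrow> area2 T' \<le> area2 T" using * by blast
qed

text \<open>Exchanging one vertex for \<open>x\<close> cannot enlarge a triangle of largest area.
  The areas compared are numerators in Cramer's rule, so all of \<open>A\<close> has coordinates at
  most 1 in absolute value.\<close>

lemma largest_triangle_coords:
  assumes "finite A" "largest_triangle A = Some (a, b, c)" "x \<in> A"
  shows "\<bar>cross (x - a) (c - a)\<bar> \<le> \<bar>cross (b - a) (c - a)\<bar>"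
    "\<bar>cross (b - a) (x - a)\<bar> \<le> \<bar>cross (b - a) (c - a)\<bar>"
  using largest_triangle_Some(1)[OF assms(1,2)]
    largest_triangle_Some(3)[OF assms(1,2), of "(a, x, c)"]
    largest_triangle_Some(3)[OF assms(1,2), of "(a, b, x)"] assms(3)
  by auto

text \<open>The mesh \<open>1 / 1024\<close> resolves an eighth of the edges of a copy of scale \<open>l = 1 / 128\<close>, the
  smallest scale used.\<close>

definition grid_size :: int where
  "grid_size = 1024"

text \<open>The grid extends beyond the triangle because candidates and their shrunken copies may
  lie outside it, with coordinates up to 2 in absolute value.\<close>

fun grid :: "triangle \<Rightarrow> point list" where
  "grid (a, b, c) =
     map (\<lambda>(i, j). a + (of_int i / of_int grid_size) *\<^sub>R (b - a)
                     + (of_int j / of_int grid_size) *\<^sub>R (c - a))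
       (List.product [- 3 * grid_size..3 * grid_size] [- 3 * grid_size..3 * grid_size])"

definition grid_count :: nat where
  "grid_count = (nat (6 * grid_size + 1))\<^sup>2"

lemma length_grid: "length (grid T) = grid_count"
  by (cases T) (simp add: grid_count_def power2_eq_square)

text \<open>\<open>H\<close> is meant as the convex function minus the target value, so that
  candidates have level at most 0. The last clause is the coordinate bound 2 with the denominator of
  Cramer's rule cleared.\<close>

definition localizes ::
  "point set \<Rightarrow> (point \<Rightarrow> real) \<Rightarrow> point set \<Rightarrow> real \<Rightarrow> triangle \<Rightarrow> bool" where
  "localizes D H C \<theta> T \<longleftrightarrow> (case T of (a, b, c) \<Rightarrow>
     a \<in> D \<and> b \<in> D \<and> c \<in> D \<and> cross (b - a) (c - a) \<noteq> 0 \<and>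
     H a \<le> \<theta> \<and> H b \<le> \<theta> \<and> H c \<le> \<theta> \<and>
     (\<forall>q\<in>C. \<bar>cross (q - a) (c - a)\<bar> \<le> 2 * \<bar>cross (b - a) (c - a)\<bar> \<and>
             \<bar>cross (b - a) (q - a)\<bar> \<le> 2 * \<bar>cross (b - a) (c - a)\<bar>))"

text \<open>Sublevel sets of a convex function are convex, hence contain the triangle spanned by any
  three of their points.\<close>

lemma convex_on_triangle_le:
  assumes "convex D" "convex_on D H" "a \<in> D" "b \<in> D" "c \<in> D"
    and "H a \<le> \<theta>" "H b \<le> \<theta>" "H c \<le> \<theta>" "0 \<le> s" "0 \<le> r" "s + r \<le> (1::real)"
  shows "a + s *\<^sub>R (b - a) + r *\<^sub>R (c - a) \<in> D"
    and "H (a + s *\<^sub>R (b - a) + r *\<^sub>R (c - a)) \<le> \<theta>"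
proof -
  have "convex {x\<in>D. H x \<le> \<theta>}"
  proof (rule convexI, safe)
    fix x y and u v :: real
    assume *: "x \<in> D" "y \<in> D" "H x \<le> \<theta>" "H y \<le> \<theta>" "0 \<le> u" "0 \<le> v" "u + v = 1"
    show "u *\<^sub>R x + v *\<^sub>R y \<in> D"
      using * \<open>convex D\<close> by (intro convexD)
    have "H (u *\<^sub>R x + v *\<^sub>R y) \<le> u * H x + v * H y"
      using assms(2) * unfolding convex_on_def by blast
    also have "\<dots> \<le> u * \<theta> + v * \<theta>" using * by (intro add_mono mult_left_mono) auto
    finally show "H (u *\<^sub>R x + v *\<^sub>R y) \<le> \<theta>" using * by (simp flip: distrib_right)
  qed
  then have hull: "convex hull {a, b, c} \<subseteq> {x\<in>D. H x \<le> \<theta>}"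
    using assms by (intro hull_minimal) auto
  have "a + s *\<^sub>R (b - a) + r *\<^sub>R (c - a) \<in> convex hull {a, b, c}"
    unfolding convex_hull_3
    by (intro CollectI exI[of _ "1 - s - r"] exI[of _ s] exI[of _ r])
       (use assms in \<open>auto simp: algebra_simps\<close>)
  with hull show "a + s *\<^sub>R (b - a) + r *\<^sub>R (c - a) \<in> D"
    and "H (a + s *\<^sub>R (b - a) + r *\<^sub>R (c - a)) \<le> \<theta>" by auto
qed

text \<open>While \<open>s\<close> runs over a window of length 1/8, \<open>r + l * s\<close> sweeps
  a length \<open>l / 8\<close>, which is at least the mesh \<open>1 / N\<close>. Rounding up
  therefore meets a grid value.\<close>

lemma ceiling_window:
  fixes r s\<^sub>0 l :: real
  assumes "0 < l" "8 \<le> l * of_int N" "0 < N"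
  obtains i :: int and s where "of_int i / of_int N = r + l * s" "s\<^sub>0 \<le> s" "s \<le> s\<^sub>0 + 1 / 8"
proof -
  define i where "i = \<lceil>of_int N * (r + l * s\<^sub>0)\<rceil>"
  define s where "s = (of_int i / of_int N - r) / l"
  have N: "(0::real) < of_int N" using assms by simp
  have 1: "of_int N * (r + l * s\<^sub>0) \<le> of_int i" "of_int i \<le> of_int N * (r + l * s\<^sub>0) + 1"
    unfolding i_def by linarith+
  have eq: "of_int i = of_int N * (r + l * s)"
    using assms N unfolding s_def by (simp add: field_simps)
  have "of_int N * (l * s\<^sub>0) \<le> of_int N * (l * s)"
    using 1 unfolding eq by (simp add: algebra_simps)
  then have a: "s\<^sub>0 \<le> s" using N assms(1) by simp
  have "of_int N * (l * s) \<le> of_int N * (l * s\<^sub>0) + 1"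
    using 1 unfolding eq by (simp add: algebra_simps)
  then have "(l * of_int N) * (s - s\<^sub>0) \<le> 1" by (simp add: algebra_simps)
  moreover have "8 * (s - s\<^sub>0) \<le> (l * of_int N) * (s - s\<^sub>0)"
    using a assms(2) by (intro mult_right_mono) auto
  ultimately have b: "s \<le> s\<^sub>0 + 1 / 8" by simp
  from that[OF _ a b, of i] eq N show ?thesis by simp
qed

text \<open>The point \<open>x\<close> mixes \<open>q\<close>, of level at most 0, with a triangle
  point of level at most \<theta> whose weight \<open>l\<close> is at most 1/2; this halves the
  level. The parameters \<open>s\<^sub>0\<close> and \<open>r\<^sub>0\<close> aim at a place in the
  copy, and each coordinate is rounded to the grid separately.\<close>

lemma grid_hits_copy:
  fixes l :: real
  assumes D: "convex D" "convex_on D H" and loc: "a \<in> D" "b \<in> D" "c \<in> D"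
    and lev: "H a \<le> \<theta>" "H b \<le> \<theta>" "H c \<le> \<theta>" "0 \<le> \<theta>"
    and q: "q \<in> D" "H q \<le> 0" "q = a + \<alpha> *\<^sub>R (b - a) + \<beta> *\<^sub>R (c - a)" "\<bar>\<alpha>\<bar> \<le> 2" "\<bar>\<beta>\<bar> \<le> 2"
    and l: "1 / 128 \<le> l" "l \<le> 1 / 2"
    and s: "0 \<le> s\<^sub>0" "0 \<le> r\<^sub>0" "s\<^sub>0 + r\<^sub>0 \<le> 1 / 2"
  obtains s r x where "s\<^sub>0 \<le> s" "s \<le> s\<^sub>0 + 1 / 8" "r\<^sub>0 \<le> r" "r \<le> r\<^sub>0 + 1 / 8"
    "x = a + ((1 - l) * \<alpha> + l * s) *\<^sub>R (b - a) + ((1 - l) * \<beta> + l * r) *\<^sub>R (c - a)"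
    "x \<in> set (grid (a, b, c))" "x \<in> D" "H x \<le> \<theta> / 2"
proof -
  have N: "0 < l" "8 \<le> l * of_int grid_size" "0 < grid_size"
    using l by (auto simp: grid_size_def)
  obtain i s where i: "of_int i / of_int grid_size = (1 - l) * \<alpha> + l * s" "s\<^sub>0 \<le> s" "s \<le> s\<^sub>0 + 1 / 8"
    using ceiling_window[OF N] by metis
  obtain j r where j: "of_int j / of_int grid_size = (1 - l) * \<beta> + l * r" "r\<^sub>0 \<le> r" "r \<le> r\<^sub>0 + 1 / 8"
    using ceiling_window[OF N] by metis
  define x where "x = a + ((1 - l) * \<alpha> + l * s) *\<^sub>R (b - a) + ((1 - l) * \<beta> + l * r) *\<^sub>R (c - a)"
  define y where "y = a + s *\<^sub>R (b - a) + r *\<^sub>R (c - a)"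
  \<comment> \<open>Rounding adds at most 1/8 to each parameter, so \<open>s + r \<le> 3/4\<close>
    and \<open>y\<close> stays in the triangle.\<close>
  have y: "y \<in> D" "H y \<le> \<theta>"
    unfolding y_def using convex_on_triangle_le[OF D loc lev(1-3), of s r] i j s by auto
  have xy: "x = (1 - l) *\<^sub>R q + l *\<^sub>R y"
    unfolding x_def y_def q(3) by (simp add: algebra_simps)
  have "x \<in> D" unfolding xy using convexD_alt[OF D(1) q(1) y(1), of l] l by simp
  have "H x \<le> (1 - l) * H q + l * H y"
    unfolding xy using convex_onD[OF D(2), of l q y] q(1) y(1) l by simp
  also have "\<dots> \<le> (1 - l) * 0 + l * \<theta>"
    using q y l by (intro add_mono mult_left_mono) auto
  also have "\<dots> \<le> \<theta> / 2" using l lev(4) mult_right_mono[of l "1/2" \<theta>] by simp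
  finally have Hx: "H x \<le> \<theta> / 2" .
  have bound: "\<bar>k\<bar> \<le> 3 * grid_size"
    if k: "of_int k / of_int grid_size = (1 - l) * \<mu> + l * v" "\<bar>\<mu>\<bar> \<le> 2" "0 \<le> v" "v \<le> 1"
    for k :: int and \<mu> v :: real
  proof -
    have "\<bar>(1 - l) * \<mu> + l * v\<bar> \<le> (1 - l) * \<bar>\<mu>\<bar> + l * v"
      using k(3) l abs_triangle_ineq[of "(1 - l) * \<mu>" "l * v"] by (simp add: abs_mult)
    also have "\<dots> \<le> (1 - l) * 2 + l * 1"
      using k(2-4) l by (intro add_mono mult_left_mono) auto
    also have "\<dots> \<le> 3" using l by simp
    finally have "\<bar>of_int k / of_int grid_size :: real\<bar> \<le> 3" using k(1) by simp
    then have "\<bar>of_int k\<bar> \<le> (3 * of_int grid_size :: real)"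
      using N(3) by (simp add: field_simps)
    then have "(of_int \<bar>k\<bar> :: real) \<le> of_int (3 * grid_size)" by simp
    then show ?thesis by (simp only: of_int_le_iff)
  qed
  have "\<bar>i\<bar> \<le> 3 * grid_size" "\<bar>j\<bar> \<le> 3 * grid_size"
    using bound[OF i(1)] bound[OF j(1)] i j q s by auto
  then have "x \<in> set (grid (a, b, c))"
    unfolding x_def by (auto simp flip: i(1) j(1) intro!: image_eqI[of _ _ "(i, j)"])
  then show ?thesis using that[OF i(2,3) j(2,3) x_def _ \<open>x \<in> D\<close> Hx] by blast
qed

text \<open>Two scales are needed to reproduce the bound \<open>2\<close> on the coordinates. The copies with
  \<open>l = 1 / 2\<close> show that the edges of the old triangle are not long compared with the new one;
  the copy with \<open>l = 1 / 128\<close> then contains a grid point of the new level close to \<open>q\<close>.\<close>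

lemma localizes_refine:
  assumes D: "convex D" "convex_on D H" and loc: "localizes D H C \<theta> T" and "0 \<le> \<theta>"
    and C: "C \<subseteq> {q\<in>D. H q \<le> 0}"
    and A: "A \<subseteq> {x\<in>D. H x \<le> \<theta>'}" "finite A"
    and hit: "\<And>x. x \<in> set (grid T) \<Longrightarrow> x \<in> D \<Longrightarrow> H x \<le> \<theta> / 2 \<Longrightarrow> x \<in> A"
  shows "case largest_triangle A of None \<Rightarrow> C = {} | Some T' \<Rightarrow> localizes D H C \<theta>' T'"
proof -
  obtain a b c where T: "T = (a, b, c)" by (cases T)
  define u where "u = b - a"
  define w where "w = c - a"
  have abc: "a \<in> D" "b \<in> D" "c \<in> D" "H a \<le> \<theta>" "H b \<le> \<theta>" "H c \<le> \<theta>"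
    and uw: "cross u w \<noteq> 0"
    and Cq: "\<And>q. q \<in> C \<Longrightarrow> \<bar>cross (q - a) w\<bar> \<le> 2 * \<bar>cross u w\<bar>"
      "\<And>q. q \<in> C \<Longrightarrow> \<bar>cross u (q - a)\<bar> \<le> 2 * \<bar>cross u w\<bar>"
    using loc unfolding localizes_def T u_def w_def by auto
  have coords: "\<exists>\<alpha> \<beta>. q = a + \<alpha> *\<^sub>R u + \<beta> *\<^sub>R w \<and> \<bar>\<alpha>\<bar> \<le> 2 \<and> \<bar>\<beta>\<bar> \<le> 2" if "q \<in> C" for q
  proof (intro exI conjI)
    show "q = a + (cross (q - a) w / cross u w) *\<^sub>R u + (cross u (q - a) / cross u w) *\<^sub>R w"
      using cross_coords[OF uw, of "q - a"] by (simp add: algebra_simps)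
    show "\<bar>cross (q - a) w / cross u w\<bar> \<le> 2" "\<bar>cross u (q - a) / cross u w\<bar> \<le> 2"
      using Cq[OF that] uw by (auto simp: field_simps)
  qed
  have copy: "\<exists>s r. s\<^sub>0 \<le> s \<and> s \<le> s\<^sub>0 + 1 / 8 \<and> r\<^sub>0 \<le> r \<and> r \<le> r\<^sub>0 + 1 / 8 \<and>
      a + ((1 - l) * \<alpha> + l * s) *\<^sub>R u + ((1 - l) * \<beta> + l * r) *\<^sub>R w \<in> A"
    if q: "q \<in> C" "q = a + \<alpha> *\<^sub>R u + \<beta> *\<^sub>R w" "\<bar>\<alpha>\<bar> \<le> 2" "\<bar>\<beta>\<bar> \<le> 2"
      and "1 / 128 \<le> l" "l \<le> 1 / 2" "0 \<le> s\<^sub>0" "0 \<le> r\<^sub>0" "s\<^sub>0 + r\<^sub>0 \<le> 1 / 2" for q \<alpha> \<beta> l s\<^sub>0 r\<^sub>0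
  proof -
    have "q \<in> D" "H q \<le> 0" using C q(1) by auto
    from grid_hits_copy[OF D abc \<open>0 \<le> \<theta>\<close> this, of \<alpha> \<beta> l s\<^sub>0 r\<^sub>0] that(2-)
    obtain s r where "s\<^sub>0 \<le> s" "s \<le> s\<^sub>0 + 1 / 8" "r\<^sub>0 \<le> r" "r \<le> r\<^sub>0 + 1 / 8"
      "a + ((1 - l) * \<alpha> + l * s) *\<^sub>R u + ((1 - l) * \<beta> + l * r) *\<^sub>R w \<in> set (grid (a, b, c)) \<inter> D"
      "H (a + ((1 - l) * \<alpha> + l * s) *\<^sub>R u + ((1 - l) * \<beta> + l * r) *\<^sub>R w) \<le> \<theta> / 2"
      unfolding u_def w_def by (metis IntI)
    then show ?thesis using hit unfolding T by blast
  qed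
  \<comment> \<open>Aiming at (0, 0), (1/2, 0) and (0, 1/2) in the copy of scale 1/2 gives three
    points of \<open>A\<close>. Their differences have a diagonally dominant matrix in the basis
    \<open>u\<close>, \<open>w\<close>, with 3/8 = 1/2 - 1/8 on the diagonal.\<close>
  have three: "\<exists>x\<^sub>0\<in>A. \<exists>x\<^sub>1\<in>A. \<exists>x\<^sub>2\<in>A. \<exists>d\<^sub>1 d\<^sub>2 d\<^sub>3 d\<^sub>4.
      x\<^sub>1 - x\<^sub>0 = (1/2) *\<^sub>R (d\<^sub>1 *\<^sub>R u + d\<^sub>2 *\<^sub>R w) \<and> x\<^sub>2 - x\<^sub>0 = (1/2) *\<^sub>R (d\<^sub>3 *\<^sub>R u + d\<^sub>4 *\<^sub>R w) \<and>
      3/8 \<le> d\<^sub>1 \<and> \<bar>d\<^sub>2\<bar> \<le> 1/8 \<and> \<bar>d\<^sub>3\<bar> \<le> 1/8 \<and> 3/8 \<le> d\<^sub>4" if q: "q \<in> C" for q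
  proof -
    obtain \<alpha> \<beta> where *: "q = a + \<alpha> *\<^sub>R u + \<beta> *\<^sub>R w" "\<bar>\<alpha>\<bar> \<le> 2" "\<bar>\<beta>\<bar> \<le> 2" using coords[OF q] by blast
    have copies: "\<exists>s r. s\<^sub>0 \<le> s \<and> s \<le> s\<^sub>0 + 1 / 8 \<and> r\<^sub>0 \<le> r \<and> r \<le> r\<^sub>0 + 1 / 8 \<and>
      a + ((1 - 1/2) * \<alpha> + 1/2 * s) *\<^sub>R u + ((1 - 1/2) * \<beta> + 1/2 * r) *\<^sub>R w \<in> A"
      if "0 \<le> s\<^sub>0" "0 \<le> r\<^sub>0" "s\<^sub>0 + r\<^sub>0 \<le> 1 / 2" for s\<^sub>0 r\<^sub>0
      using copy[OF q *, of "1/2" s\<^sub>0 r\<^sub>0] that by simp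
    obtain s\<^sub>0 r\<^sub>0 where 0: "0 \<le> s\<^sub>0" "s\<^sub>0 \<le> 1/8" "0 \<le> r\<^sub>0" "r\<^sub>0 \<le> 1/8"
      "a + ((1 - 1/2) * \<alpha> + 1/2 * s\<^sub>0) *\<^sub>R u + ((1 - 1/2) * \<beta> + 1/2 * r\<^sub>0) *\<^sub>R w \<in> A" (is "?x0 \<in> A")
      using copies[of 0 0] by auto
    obtain s\<^sub>1 r\<^sub>1 where 1: "1/2 \<le> s\<^sub>1" "s\<^sub>1 \<le> 1/2 + 1/8" "0 \<le> r\<^sub>1" "r\<^sub>1 \<le> 1/8"
      "a + ((1 - 1/2) * \<alpha> + 1/2 * s\<^sub>1) *\<^sub>R u + ((1 - 1/2) * \<beta> + 1/2 * r\<^sub>1) *\<^sub>R w \<in> A" (is "?x1 \<in> A")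
      using copies[of "1/2" 0] by auto
    obtain s\<^sub>2 r\<^sub>2 where 2: "0 \<le> s\<^sub>2" "s\<^sub>2 \<le> 1/8" "1/2 \<le> r\<^sub>2" "r\<^sub>2 \<le> 1/2 + 1/8"
      "a + ((1 - 1/2) * \<alpha> + 1/2 * s\<^sub>2) *\<^sub>R u + ((1 - 1/2) * \<beta> + 1/2 * r\<^sub>2) *\<^sub>R w \<in> A" (is "?x2 \<in> A")
      using copies[of 0 "1/2"] by auto
    have "?x1 - ?x0 = (1/2) *\<^sub>R ((s\<^sub>1 - s\<^sub>0) *\<^sub>R u + (r\<^sub>1 - r\<^sub>0) *\<^sub>R w)"
      by (simp add: algebra_simps)
    moreover have "?x2 - ?x0 = (1/2) *\<^sub>R ((s\<^sub>2 - s\<^sub>0) *\<^sub>R u + (r\<^sub>2 - r\<^sub>0) *\<^sub>R w)"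
      by (simp add: algebra_simps)
    moreover have "3/8 \<le> s\<^sub>1 - s\<^sub>0" "\<bar>r\<^sub>1 - r\<^sub>0\<bar> \<le> 1/8" "\<bar>s\<^sub>2 - s\<^sub>0\<bar> \<le> 1/8" "3/8 \<le> r\<^sub>2 - r\<^sub>0"
      using 0(1-4) 1(1-4) 2(1-4) by linarith+
    ultimately show ?thesis using 0(5) 1(5) 2(5) by blast
  qed
  show ?thesis
  proof (cases "largest_triangle A")
    case None
    have "False" if q: "q \<in> C" for q
    proof -
      obtain x\<^sub>0 x\<^sub>1 x\<^sub>2 d\<^sub>1 d\<^sub>2 d\<^sub>3 d\<^sub>4 where x: "x\<^sub>0 \<in> A" "x\<^sub>1 \<in> A" "x\<^sub>2 \<in> A"
        "x\<^sub>1 - x\<^sub>0 = (1/2) *\<^sub>R (d\<^sub>1 *\<^sub>R u + d\<^sub>2 *\<^sub>R w)" "x\<^sub>2 - x\<^sub>0 = (1/2) *\<^sub>R (d\<^sub>3 *\<^sub>R u + d\<^sub>4 *\<^sub>R w)"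
        "3/8 \<le> d\<^sub>1" "\<bar>d\<^sub>2\<bar> \<le> 1/8" "\<bar>d\<^sub>3\<bar> \<le> 1/8" "3/8 \<le> d\<^sub>4"
        using three[OF q] by blast
      have "cross (x\<^sub>1 - x\<^sub>0) (x\<^sub>2 - x\<^sub>0) = 1/4 * (d\<^sub>1 * d\<^sub>4 - d\<^sub>2 * d\<^sub>3) * cross u w"
        unfolding x(4,5) using cross_commute[of w u]
        by (simp add: cross_simps algebra_simps)
      moreover have "cross (x\<^sub>1 - x\<^sub>0) (x\<^sub>2 - x\<^sub>0) = 0"
        using largest_triangle_None[OF None] x by blast
      moreover have "d\<^sub>1 * d\<^sub>4 - d\<^sub>2 * d\<^sub>3 > 0"
      proof -
        have "3/8 * (3/8) \<le> d\<^sub>1 * d\<^sub>4" using x by (intro mult_mono) auto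
        moreover have "\<bar>d\<^sub>2 * d\<^sub>3\<bar> \<le> 1/8 * (1/8)" unfolding abs_mult using x by (intro mult_mono) auto
        ultimately show ?thesis by linarith
      qed
      ultimately show False using uw by simp
    qed
    then show ?thesis using None by auto
  next
    case (Some T')
    obtain a' b' c' where T': "T' = (a', b', c')" by (cases T')
    define \<Delta> where "\<Delta> = \<bar>cross (b' - a') (c' - a')\<bar>"
    have mem: "a' \<in> A" "b' \<in> A" "c' \<in> A" and \<Delta>: "\<Delta> > 0"
      using largest_triangle_Some(1,2)[OF A(2) Some] unfolding T' \<Delta>_def by auto
    \<comment> \<open>Both numerators of Cramer's rule for the new triangle are linear functionals
      bounded by \<Delta> on \<open>A\<close> relative to \<open>a'\<close>, so one argument for a
      general \<open>L\<close> covers them.\<close>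
    have bound: "\<bar>L (q - a')\<bar> \<le> 2 * \<Delta>"
      if L: "\<And>x y. L (x + y) = L x + L y" "\<And>r x. L (r *\<^sub>R x) = r * L x"
        and LA: "\<And>x. x \<in> A \<Longrightarrow> \<bar>L (x - a')\<bar> \<le> \<Delta>" and q: "q \<in> C"
      for L :: "point \<Rightarrow> real" and q
    proof -
      have Lm: "L (x - y) = L x - L y" for x y
        using L(1)[of "x - y" y] by simp
      obtain \<alpha> \<beta> where *: "q = a + \<alpha> *\<^sub>R u + \<beta> *\<^sub>R w" "\<bar>\<alpha>\<bar> \<le> 2" "\<bar>\<beta>\<bar> \<le> 2" using coords[OF q] by blast
      obtain x\<^sub>0 x\<^sub>1 x\<^sub>2 d\<^sub>1 d\<^sub>2 d\<^sub>3 d\<^sub>4 where x: "x\<^sub>0 \<in> A" "x\<^sub>1 \<in> A" "x\<^sub>2 \<in> A"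
        "x\<^sub>1 - x\<^sub>0 = (1/2) *\<^sub>R (d\<^sub>1 *\<^sub>R u + d\<^sub>2 *\<^sub>R w)" "x\<^sub>2 - x\<^sub>0 = (1/2) *\<^sub>R (d\<^sub>3 *\<^sub>R u + d\<^sub>4 *\<^sub>R w)"
        "3/8 \<le> d\<^sub>1" "\<bar>d\<^sub>2\<bar> \<le> 1/8" "\<bar>d\<^sub>3\<bar> \<le> 1/8" "3/8 \<le> d\<^sub>4"
        using three[OF q] by blast
      have "\<bar>L (x\<^sub>1 - x\<^sub>0)\<bar> \<le> 2 * \<Delta>" "\<bar>L (x\<^sub>2 - x\<^sub>0)\<bar> \<le> 2 * \<Delta>"
        using LA[OF x(1)] LA[OF x(2)] LA[OF x(3)] by (auto simp: Lm)
      then have e: "\<bar>d\<^sub>1 * L u + d\<^sub>2 * L w\<bar> \<le> 4 * \<Delta>" "\<bar>d\<^sub>3 * L u + d\<^sub>4 * L w\<bar> \<le> 4 * \<Delta>"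
        unfolding x(4,5) by (auto simp: L)
      have "3/8 * \<bar>L u\<bar> \<le> \<bar>d\<^sub>1 * L u\<bar>" "3/8 * \<bar>L w\<bar> \<le> \<bar>d\<^sub>4 * L w\<bar>"
        unfolding abs_mult using x by (intro mult_right_mono; simp)+
      moreover have "\<bar>d\<^sub>2 * L w\<bar> \<le> 1/8 * \<bar>L w\<bar>" "\<bar>d\<^sub>3 * L u\<bar> \<le> 1/8 * \<bar>L u\<bar>"
        unfolding abs_mult using x by (intro mult_right_mono; simp)+
      \<comment> \<open>Adding the two inequalities of \<open>e\<close> leaves 1/4 of the sum on the
        left and \<open>8 * \<Delta>\<close> on the right.\<close>
      ultimately have UW: "\<bar>L u\<bar> + \<bar>L w\<bar> \<le> 32 * \<Delta>" using e by linarith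
      \<comment> \<open>At scale 1/128 the grid point differs from \<open>q\<close> by at most 3/128
        of each edge. Under \<open>L\<close> this is at most \<open>3 * 32 / 128 * \<Delta>\<close>,
        less than \<Delta>, which is added to the bound \<Delta> for points of
        \<open>A\<close>.\<close>
      obtain s r where sr: "0 \<le> s" "s \<le> 1/8" "0 \<le> r" "r \<le> 1/8" and
        y: "a + ((1 - 1/128) * \<alpha> + 1/128 * s) *\<^sub>R u + ((1 - 1/128) * \<beta> + 1/128 * r) *\<^sub>R w \<in> A" (is "?y \<in> A")
        using copy[OF q *, of "1/128" 0 0] by auto
      have "(a + \<alpha> *\<^sub>R u + \<beta> *\<^sub>R w) - a' = (a + ((1 - l) * \<alpha> + l * s) *\<^sub>R u + ((1 - l) * \<beta> + l * r) *\<^sub>R w - a')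
          + l *\<^sub>R ((\<alpha> - s) *\<^sub>R u + (\<beta> - r) *\<^sub>R w)" for l :: real
        by (simp add: algebra_simps)
      then have "q - a' = (?y - a') + (1/128) *\<^sub>R ((\<alpha> - s) *\<^sub>R u + (\<beta> - r) *\<^sub>R w)"
        unfolding *(1) .
      then have "L (q - a') = L (?y - a') + 1/128 * ((\<alpha> - s) * L u + (\<beta> - r) * L w)"
        by (simp only: L)
      moreover define X Y where "X = (\<alpha> - s) * L u" and "Y = (\<beta> - r) * L w"
      moreover have "\<bar>X\<bar> \<le> 3 * \<bar>L u\<bar>" "\<bar>Y\<bar> \<le> 3 * \<bar>L w\<bar>"
        unfolding abs_mult X_def Y_def using * sr by (intro mult_right_mono; linarith)+
      moreover define Z where "Z = L (?y - a')"
      moreover have "\<bar>Z\<bar> \<le> \<Delta>" unfolding Z_def by (rule LA[OF y])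
      ultimately have "L (q - a') = Z + 1/128 * (X + Y)" "\<bar>X\<bar> \<le> 3 * \<bar>L u\<bar>" "\<bar>Y\<bar> \<le> 3 * \<bar>L w\<bar>" "\<bar>Z\<bar> \<le> \<Delta>"
        by simp_all
      moreover from this have "128 * L (q - a') = 128 * Z + X + Y" by simp
      ultimately show ?thesis using UW \<Delta> by linarith
    qed
    have "\<bar>cross (q - a') (c' - a')\<bar> \<le> 2 * \<Delta> \<and> \<bar>cross (b' - a') (q - a')\<bar> \<le> 2 * \<Delta>" if "q \<in> C" for q
      using bound[of "\<lambda>x. cross x (c' - a')", OF cross_simps(1,5) _ that]
        bound[of "cross (b' - a')", OF cross_simps(2,6) _ that]
        largest_triangle_coords[OF A(2) Some[unfolded T'], folded \<Delta>_def]
      by blast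
    then show ?thesis
      using Some mem A(1) \<Delta> unfolding T' localizes_def \<Delta>_def by auto
  qed
qed

section \<open>Lattice-free triangles are flat\<close>

definition lattice_point :: "int \<times> int \<Rightarrow> point" where
  "lattice_point p = (of_int (fst p), of_int (snd p))"

definition icross :: "int \<times> int \<Rightarrow> int \<times> int \<Rightarrow> int" where
  "icross p q = fst p * snd q - snd p * fst q"

lemma cross_lattice_point: "cross (lattice_point p) (lattice_point q) = of_int (icross p q)"
  by (simp add: cross_def icross_def lattice_point_def)

lemma lattice_point_add: "lattice_point (p + q) = lattice_point p + lattice_point q"
  by (simp add: lattice_point_def)

definition multiple :: "int \<Rightarrow> int \<times> int \<Rightarrow> int \<times> int" where
  "multiple k p = (k * fst p, k * snd p)"

lemma lattice_point_multiple: "lattice_point (multiple k p) = of_int k *\<^sub>R lattice_point p"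
  by (simp add: lattice_point_def multiple_def)

text \<open>By Bezout, a primitive vector extends to a basis of the integer lattice.\<close>

lemma icross_unit_exists:
  assumes "coprime (fst b) (snd b)"
  obtains a where "icross b a = 1"
proof -
  obtain u v where "u * fst b + v * snd b = gcd (fst b) (snd b)"
    using bezout_int by blast
  then have "icross b (- v, u) = 1"
    using assms by (simp add: icross_def algebra_simps)
  then show ?thesis using that by blast
qed

text \<open>Expanding \<open>p\<close> in the basis \<open>u\<close>, \<open>w\<close> by Cramer's
  rule bounds both of its components. This is what lets the quadratic form below attain its
  minimum.\<close>

lemma finite_bounded_lattice_points:
  assumes "cross u w \<noteq> 0"
  shows "finite {p. \<bar>cross (lattice_point p) w\<bar> \<le> r \<and> \<bar>cross u (lattice_point p)\<bar> \<le> r}" (is "finite ?S")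
proof -
  define M where "M = \<lceil>\<bar>r\<bar> * (\<bar>fst u\<bar> + \<bar>fst w\<bar> + \<bar>snd u\<bar> + \<bar>snd w\<bar>) / \<bar>cross u w\<bar>\<rceil>"
  have comp: "\<bar>k\<bar> \<le> M"
    if k: "of_int k = x / cross u w * fu + y / cross u w * fw" and xy: "\<bar>x\<bar> \<le> r" "\<bar>y\<bar> \<le> r"
      and f: "\<bar>fu\<bar> + \<bar>fw\<bar> \<le> \<bar>fst u\<bar> + \<bar>fst w\<bar> + \<bar>snd u\<bar> + \<bar>snd w\<bar>" for k x y fu fw
  proof -
    have "of_int k * cross u w = x * fu + y * fw"
      using assms unfolding k by (simp add: field_simps)
    then have "\<bar>of_int k * cross u w\<bar> = \<bar>x * fu + y * fw\<bar>" by simp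
    also have "\<dots> \<le> \<bar>x\<bar> * \<bar>fu\<bar> + \<bar>y\<bar> * \<bar>fw\<bar>"
      using abs_triangle_ineq[of "x * fu" "y * fw"] by (simp add: abs_mult)
    also have "\<dots> \<le> \<bar>r\<bar> * \<bar>fu\<bar> + \<bar>r\<bar> * \<bar>fw\<bar>"
      using xy by (intro add_mono mult_right_mono) auto
    also have "\<dots> \<le> \<bar>r\<bar> * (\<bar>fst u\<bar> + \<bar>fst w\<bar> + \<bar>snd u\<bar> + \<bar>snd w\<bar>)"
      using f by (simp add: mult_left_mono flip: distrib_left)
    finally have "\<bar>of_int k\<bar> \<le> \<bar>r\<bar> * (\<bar>fst u\<bar> + \<bar>fst w\<bar> + \<bar>snd u\<bar> + \<bar>snd w\<bar>) / \<bar>cross u w\<bar>"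
      using assms by (simp add: abs_mult pos_le_divide_eq)
    then show ?thesis unfolding M_def by linarith
  qed
  have "?S \<subseteq> {-M..M} \<times> {-M..M}"
  proof
    fix p assume p: "p \<in> ?S"
    have eq: "lattice_point p = (cross (lattice_point p) w / cross u w) *\<^sub>R u
      + (cross u (lattice_point p) / cross u w) *\<^sub>R w"
      by (rule cross_coords[OF assms])
    have "of_int (fst p) = cross (lattice_point p) w / cross u w * fst u
      + cross u (lattice_point p) / cross u w * fst w"
      using arg_cong[OF eq, of fst] by (simp add: lattice_point_def)
    moreover have "of_int (snd p) = cross (lattice_point p) w / cross u w * snd u
      + cross u (lattice_point p) / cross u w * snd w"
      using arg_cong[OF eq, of snd] by (simp add: lattice_point_def)
    ultimately have "\<bar>fst p\<bar> \<le> M" "\<bar>snd p\<bar> \<le> M"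
      using p comp[of "fst p" "cross (lattice_point p) w" "fst u" "cross u (lattice_point p)" "fst w"]
        comp[of "snd p" "cross (lattice_point p) w" "snd u" "cross u (lattice_point p)" "snd w"]
      by auto
    then show "p \<in> {-M..M} \<times> {-M..M}" by (cases p) auto
  qed
  then show ?thesis by (rule finite_subset) simp
qed

text \<open>Hermite's bound for the minimum of a positive definite binary quadratic form, here the
  squared length of the integer vector in the coordinates given by \<open>u\<close> and \<open>w\<close>.\<close>

lemma short_primitive_vector:
  assumes uw: "cross u w \<noteq> 0"
  obtains b where "coprime (fst b) (snd b)"
    "(cross (lattice_point b) w)\<^sup>2 + (cross u (lattice_point b))\<^sup>2 \<le> 2 * \<bar>cross u w\<bar>"
proof -
  define Q where "Q p = (cross (lattice_point p) w)\<^sup>2 + (cross u (lattice_point p))\<^sup>2" for p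
  \<comment> \<open>Cutting off at the value of one nonzero vector leaves a finite nonempty set,
    whose minimizer is minimal among all nonzero integer vectors.\<close>
  define S where "S = {p. p \<noteq> 0 \<and> Q p \<le> Q (1, 0)}"
  have "\<bar>cross (lattice_point p) w\<bar> \<le> sqrt (Q (1, 0)) \<and> \<bar>cross u (lattice_point p)\<bar> \<le> sqrt (Q (1, 0))"
    if "Q p \<le> Q (1, 0)" for p
    using that by (auto intro!: real_le_rsqrt simp: Q_def) (smt (verit) zero_le_power2)+
  then have "S \<subseteq> {p. \<bar>cross (lattice_point p) w\<bar> \<le> sqrt (Q (1, 0)) \<and> \<bar>cross u (lattice_point p)\<bar> \<le> sqrt (Q (1, 0))}"
    unfolding S_def by blast
  then have "finite S"
    by (rule finite_subset) (rule finite_bounded_lattice_points[OF uw])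
  moreover have "(1, 0) \<in> S" by (simp add: S_def zero_prod_def)
  ultimately obtain b where "is_arg_min Q (\<lambda>p. p \<in> S) b"
    using ex_is_arg_min_if_finite by blast
  then have b: "b \<noteq> 0" "Q b \<le> Q (1, 0)" and "\<And>p. p \<in> S \<Longrightarrow> Q b \<le> Q p"
    by (auto simp: is_arg_min_linorder S_def)
  then have min: "Q b \<le> Q p" if "p \<noteq> 0" for p
    using that b(2) unfolding S_def by (cases "Q p \<le> Q (1, 0)") auto
  have Qpos: "Q p > 0" if "p \<noteq> 0" for p
  proof (rule ccontr)
    assume "\<not> Q p > 0"
    then have "cross (lattice_point p) w = 0" "cross u (lattice_point p) = 0"
      unfolding Q_def by (simp_all add: not_sum_power2_lt_zero sum_power2_gt_zero_iff)
    then have "lattice_point p = 0"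
      using cross_coords[OF uw, of "lattice_point p"] by simp
    then show False using that by (cases p) (simp add: lattice_point_def zero_prod_def)
  qed
  \<comment> \<open>Dividing \<open>b\<close> by the gcd \<open>d\<close> of its components divides
    \<open>Q b\<close> by the square of \<open>d\<close>, so minimality forces
    \<open>d = 1\<close>.\<close>
  have cop: "coprime (fst b) (snd b)"
  proof -
    define d where "d = gcd (fst b) (snd b)"
    obtain x y where xy: "fst b = d * x" "snd b = d * y"
      unfolding d_def by (meson dvdE gcd_dvd1 gcd_dvd2)
    have bxy: "b = multiple d (x, y)" by (simp add: multiple_def flip: xy)
    then have nz: "(x, y) \<noteq> 0" using b(1) by (auto simp: multiple_def zero_prod_def)
    have "Q b = (of_int d)\<^sup>2 * Q (x, y)"
      unfolding Q_def bxy lattice_point_multiple by (simp add: cross_simps power_mult_distrib algebra_simps)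
    with min[OF nz] Qpos[OF nz] have "(of_int d)\<^sup>2 \<le> (1::real)" by simp
    then have "\<bar>d\<bar> \<le> 1" by (simp add: abs_square_le_1 flip: of_int_power)
    moreover have "d > 0" using b(1) unfolding d_def by (cases b) (auto simp: zero_prod_def)
    ultimately have "d = 1" by simp
    then show ?thesis unfolding d_def by (simp add: coprime_iff_gcd_eq_1)
  qed
  obtain a where a: "icross b a = 1" using icross_unit_exists[OF cop] .
  define ip where "ip p = cross (lattice_point p) w * cross (lattice_point b) w
    + cross u (lattice_point p) * cross u (lattice_point b)" for p
  \<comment> \<open>Gauss reduction: subtracting the nearest integer multiple of \<open>b\<close>
    makes the inner product with \<open>b\<close> at most half of \<open>Q b\<close>.\<close>
  define l where "l = - round (ip a / Q b)"
  define a' where "a' = a + multiple l b"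
  have Qb: "Q b > 0" using Qpos b(1) by blast
  have a': "icross b a' = 1" using a by (simp add: a'_def icross_def multiple_def algebra_simps)
  have "a' \<noteq> 0" using a' by (auto simp: icross_def)
  have "ip a' = ip a + of_int l * Q b"
    unfolding ip_def Q_def a'_def lattice_point_add lattice_point_multiple
    by (simp add: cross_simps power2_eq_square algebra_simps)
  also have "\<dots> = Q b * (ip a / Q b - of_int (round (ip a / Q b)))"
    using Qb unfolding l_def by (simp add: field_simps)
  finally have "\<bar>ip a'\<bar> = Q b * \<bar>of_int (round (ip a / Q b)) - ip a / Q b\<bar>"
    using Qb by (simp add: abs_mult abs_minus_commute)
  also have "\<dots> \<le> Q b * (1 / 2)"
    using Qb of_int_round_abs_le by (intro mult_left_mono) auto
  finally have "\<bar>ip a'\<bar>\<^sup>2 \<le> (Q b * (1 / 2))\<^sup>2" by (intro power_mono) auto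
  then have ip: "(ip a')\<^sup>2 \<le> (Q b)\<^sup>2 / 4" by (simp add: power2_eq_square)
  \<comment> \<open>Lagrange's identity. The determinant of the coordinate map is
    \<open>cross u w\<close>, and that of the lattice basis is 1.\<close>
  have "Q a' * Q b = (ip a')\<^sup>2 + (cross u w)\<^sup>2 * (cross (lattice_point b) (lattice_point a'))\<^sup>2"
    unfolding Q_def ip_def cross_def by (simp add: algebra_simps power2_eq_square)
  also have "\<dots> = (ip a')\<^sup>2 + (cross u w)\<^sup>2"
    unfolding cross_lattice_point a' by simp
  finally have "Q b * Q b \<le> (Q b)\<^sup>2 / 4 + (cross u w)\<^sup>2"
    using ip mult_right_mono[OF min[OF \<open>a' \<noteq> 0\<close>], of "Q b"] Qb by linarith
  moreover have "0 \<le> (cross u w)\<^sup>2" by simp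
  ultimately have "(Q b)\<^sup>2 \<le> 4 * (cross u w)\<^sup>2"
    unfolding power2_eq_square by linarith
  then have "(Q b)\<^sup>2 \<le> (2 * \<bar>cross u w\<bar>)\<^sup>2"
    by (simp add: power_mult_distrib)
  then have "Q b \<le> 2 * \<bar>cross u w\<bar>"
    by (rule power2_le_imp_le) simp
  then show ?thesis using that[OF cop] unfolding Q_def by simp
qed

text \<open>The lattice is a union of lines parallel to \<open>b\<close>, one for each integer value
  of \<open>cross (lattice_point b)\<close>. Moving along \<open>w\<close> by \<open>e\<close>
  reaches such a line, and moving along \<open>b\<close> by the fractional part \<tau> then reaches
  a lattice point.\<close>

lemma lattice_point_on_line_near:
  assumes "icross b a = 1" "0 < \<bar>cross (lattice_point b) w\<bar>"
  obtains p e \<tau> where "lattice_point p = x - e *\<^sub>R w - \<tau> *\<^sub>R lattice_point b"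
    "\<bar>e\<bar> \<le> 1 / \<bar>cross (lattice_point b) w\<bar>" "0 \<le> \<tau>" "\<tau> \<le> 1"
proof -
  let ?b = "lattice_point b" and ?a = "lattice_point a"
  have ba: "cross ?b ?a = 1" using assms(1) by (simp add: cross_lattice_point)
  define k where "k = \<lfloor>cross ?b x\<rfloor>"
  define e where "e = (cross ?b x - of_int k) / cross ?b w"
  define y where "y = x - of_int k *\<^sub>R ?a - e *\<^sub>R w"
  have "cross ?b y = 0"
    using assms(2) ba unfolding y_def e_def by (simp add: cross_simps)
  then have y: "y = cross y ?a *\<^sub>R ?b"
    using cross_coords[of ?b ?a y] ba by simp
  define l where "l = \<lfloor>cross y ?a\<rfloor>"
  have "lattice_point (multiple k a + multiple l b) = x - e *\<^sub>R w - (cross y ?a - of_int l) *\<^sub>R ?b"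
    using y unfolding y_def
    by (simp add: lattice_point_add lattice_point_multiple algebra_simps)
  moreover have "\<bar>e\<bar> \<le> 1 / \<bar>cross ?b w\<bar>"
    unfolding e_def abs_divide k_def by (intro divide_right_mono) linarith+
  moreover have "0 \<le> cross y ?a - of_int l" "cross y ?a - of_int l \<le> 1"
    unfolding l_def by linarith+
  ultimately show ?thesis using that by blast
qed

text \<open>The short primitive vector works. If an edge were wide with respect to it, a short move
  along that edge and a step along \<open>b\<close> would lead from the interior point with
  coordinates (1/4, 1/4) to a lattice point of the triangle.\<close>

lemma flat_lattice_free_triangle:
  assumes uw: "cross u w \<noteq> 0"
    and free: "\<And>p s r. 0 \<le> s \<Longrightarrow> 0 \<le> r \<Longrightarrow> s + r \<le> 1 \<Longrightarrow> lattice_point p \<noteq> a + s *\<^sub>R u + r *\<^sub>R w"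
  obtains b where "coprime (fst b) (snd b)"
    "\<bar>cross (lattice_point b) u\<bar> \<le> 12" "\<bar>cross (lattice_point b) w\<bar> \<le> 12"
proof -
  obtain b where cop: "coprime (fst b) (snd b)" and
    b: "(cross (lattice_point b) w)\<^sup>2 + (cross u (lattice_point b))\<^sup>2 \<le> 2 * \<bar>cross u w\<bar>"
    using short_primitive_vector[OF uw] .
  let ?b = "lattice_point b"
  define \<alpha> \<beta> where "\<alpha> = cross ?b w / cross u w" and "\<beta> = cross u ?b / cross u w"
  have coords: "?b = \<alpha> *\<^sub>R u + \<beta> *\<^sub>R w"
    unfolding \<alpha>_def \<beta>_def by (rule cross_coords[OF uw])
  define R where "R = max \<bar>cross ?b u\<bar> \<bar>cross ?b w\<bar>"
  have "R \<le> 12"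
  proof (rule ccontr)
    assume "\<not> R \<le> 12"
    then have R: "R > 12" by simp
    have RR: "R\<^sup>2 \<le> 2 * \<bar>cross u w\<bar>"
    proof -
      have "R\<^sup>2 \<le> (cross ?b w)\<^sup>2 + (cross u ?b)\<^sup>2"
        unfolding R_def by (subst (2) cross_commute) (auto simp: max_def)
      then show ?thesis using b by linarith
    qed
    \<comment> \<open>\<open>RR\<close> bounds the quotient by \<open>2 / R\<close>, which is below
      1/6.\<close>
    have small: "\<bar>z\<bar> / \<bar>cross u w\<bar> \<le> 1 / 6" if "\<bar>z\<bar> \<le> R" for z
    proof -
      have "12 * \<bar>z\<bar> \<le> R * R" using that R by (intro mult_mono) auto
      then show ?thesis using RR uw by (simp add: power2_eq_square field_simps)
    qed
    have ab: "\<bar>\<alpha>\<bar> \<le> 1/6" "\<bar>\<beta>\<bar> \<le> 1/6"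
      using small[of "cross ?b w"] small[of "cross ?b u"] cross_commute[of u ?b]
      unfolding \<alpha>_def \<beta>_def R_def by (auto simp: abs_divide)
    obtain d where d: "icross b d = 1" using icross_unit_exists[OF cop] .
    \<comment> \<open>Each coordinate moves by at most 1/12 + 1/6 = 1/4, so both remain between 0
      and 1/2 and their sum is at most 1.\<close>
    have *: False if p: "lattice_point p = (a + (1/4) *\<^sub>R u + (1/4) *\<^sub>R w) - x *\<^sub>R u - y *\<^sub>R w - \<tau> *\<^sub>R ?b"
      and "\<bar>x\<bar> \<le> 1/12" "\<bar>y\<bar> \<le> 1/12" "0 \<le> \<tau>" "\<tau> \<le> 1" for p x y \<tau>
    proof -
      have "lattice_point p = a + (1/4 - x - \<tau> * \<alpha>) *\<^sub>R u + (1/4 - y - \<tau> * \<beta>) *\<^sub>R w"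
        unfolding p by (subst coords) (simp add: algebra_simps)
      moreover have "\<bar>\<tau> * \<alpha>\<bar> \<le> 1 * (1/6)" "\<bar>\<tau> * \<beta>\<bar> \<le> 1 * (1/6)"
        unfolding abs_mult using that ab by (intro mult_mono; simp)+
      ultimately show False using free[of "1/4 - x - \<tau> * \<alpha>" "1/4 - y - \<tau> * \<beta>" p] that(2,3) by simp
    qed
    show False
    \<comment> \<open>The move is made along the edge attaining the maximum \<open>R\<close>, for
      which it is shorter than 1/12 of the edge.\<close>
    proof (cases "R = \<bar>cross ?b w\<bar>")
      case True
      obtain p e \<tau> where p: "lattice_point p = (a + (1/4) *\<^sub>R u + (1/4) *\<^sub>R w) - e *\<^sub>R w - \<tau> *\<^sub>R ?b"
        "\<bar>e\<bar> \<le> 1 / \<bar>cross ?b w\<bar>" "0 \<le> \<tau>" "\<tau> \<le> 1"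
        using lattice_point_on_line_near[OF d, of w "a + (1/4) *\<^sub>R u + (1/4) *\<^sub>R w"] True R
        by (metis less_trans zero_less_numeral)
      have "1 / \<bar>cross ?b w\<bar> \<le> 1 / 12" using True R by (intro divide_left_mono) auto
      then show False using *[of p 0 e \<tau>] p by simp
    next
      case False
      then have Ru: "R = \<bar>cross ?b u\<bar>" unfolding R_def by (auto simp: max_def split: if_splits)
      obtain p e \<tau> where p: "lattice_point p = (a + (1/4) *\<^sub>R u + (1/4) *\<^sub>R w) - e *\<^sub>R u - \<tau> *\<^sub>R ?b"
        "\<bar>e\<bar> \<le> 1 / \<bar>cross ?b u\<bar>" "0 \<le> \<tau>" "\<tau> \<le> 1"
        using lattice_point_on_line_near[OF d, of u "a + (1/4) *\<^sub>R u + (1/4) *\<^sub>R w"] Ru R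
        by (metis less_trans zero_less_numeral)
      have "1 / \<bar>cross ?b u\<bar> \<le> 1 / 12" using Ru R by (intro divide_left_mono) auto
      then show False using *[of p e 0 \<tau>] p by simp
    qed
  qed
  then show ?thesis using that[OF cop] unfolding R_def by simp
qed

section \<open>Adaptive procedures\<close>

text \<open>Searches are written in continuation-passing style because \<open>procedure\<close> has
  no sequencing. Quantifying over every continuation makes this a compositional triple: possible
  results \<open>R\<close>, cost at most \<open>N\<close>.\<close>

definition runs ::
  "('x::real_vector \<times> 'y \<Rightarrow> ereal) \<Rightarrow> ('x \<Rightarrow> real) \<Rightarrow> ('x \<Rightarrow> 'y)
     \<Rightarrow> (('r \<Rightarrow> ('x, 'y) procedure) \<Rightarrow> ('x, 'y) procedure) \<Rightarrow> 'r set \<Rightarrow> nat \<Rightarrow> bool" where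
  "runs f g ysel m R N \<longleftrightarrow>
     (\<forall>k. \<exists>r\<in>R. outcome f g ysel (m k) = outcome f g ysel (k r) \<and>
                 f_evaluations f g ysel (m k) \<le> N + f_evaluations f g ysel (k r))"

lemma runs_return: "r \<in> R \<Longrightarrow> runs f g ysel (\<lambda>k. k r) R N"
  by (auto simp: runs_def)

lemma runs_bind:
  assumes "runs f g ysel m R N" "\<And>r. r \<in> R \<Longrightarrow> runs f g ysel (c r) R' N'"
  shows "runs f g ysel (\<lambda>k. m (\<lambda>r. c r k)) R' (N + N')"
  unfolding runs_def
proof
  fix k
  obtain r where r: "r \<in> R" "outcome f g ysel (m (\<lambda>r. c r k)) = outcome f g ysel (c r k)"
    "f_evaluations f g ysel (m (\<lambda>r. c r k)) \<le> N + f_evaluations f g ysel (c r k)"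
    using assms(1) unfolding runs_def by metis
  obtain r' where "r' \<in> R'" "outcome f g ysel (c r k) = outcome f g ysel (k r')"
    "f_evaluations f g ysel (c r k) \<le> N' + f_evaluations f g ysel (k r')"
    using assms(2)[OF r(1)] unfolding runs_def by metis
  with r show "\<exists>r\<in>R'. outcome f g ysel (m (\<lambda>r. c r k)) = outcome f g ysel (k r) \<and>
      f_evaluations f g ysel (m (\<lambda>r. c r k)) \<le> N + N' + f_evaluations f g ysel (k r)"
    by (intro bexI[of _ r']) auto
qed

lemma runs_weaken: "runs f g ysel m R N \<Longrightarrow> R \<subseteq> R' \<Longrightarrow> N \<le> N' \<Longrightarrow> runs f g ysel m R' N'"
  unfolding runs_def by (meson add_le_mono1 order_trans subsetD)

text \<open>Answers are collected in a function. Its default 0 outside the list is never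
  consulted.\<close>

primrec ask_g :: "'x list \<Rightarrow> (('x \<Rightarrow> real) \<Rightarrow> ('x, 'y) procedure) \<Rightarrow> ('x, 'y) procedure" where
  "ask_g [] k = k (\<lambda>_. 0)"
| "ask_g (x # xs) k = Eval_g x (\<lambda>v. ask_g xs (\<lambda>G. k (G(x := v))))"

lemma runs_ask_g: "runs f g ysel (ask_g xs) {G. \<forall>x\<in>set xs. G x = g x} 0"
proof (induction xs)
  case (Cons x xs)
  have "runs f g ysel (\<lambda>k. ask_g xs (\<lambda>G. k (G(x := g x)))) {G. \<forall>x\<in>set (x # xs). G x = g x} (0 + 0)"
    using Cons by (rule runs_bind) (auto intro!: runs_return)
  then show ?case by (simp add: runs_def)
qed (auto simp: runs_def)

primrec ask_val :: "'x list \<Rightarrow> (('x \<Rightarrow> real) \<Rightarrow> ('x, 'y) procedure) \<Rightarrow> ('x, 'y) procedure" where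
  "ask_val [] k = k (\<lambda>_. 0)"
| "ask_val (x # xs) k =
     Ask_y x (\<lambda>y. Eval_f (x, y) (\<lambda>v. ask_val xs (\<lambda>W. k (W(x := real_of_ereal v)))))"

lemma runs_ask_val:
  "runs f g ysel (ask_val xs) {W. \<forall>x\<in>set xs. W x = real_of_ereal (f (x, ysel x))} (length xs)"
proof (induction xs)
  case (Cons x xs)
  have "runs f g ysel (\<lambda>k. ask_val xs (\<lambda>W. k (W(x := real_of_ereal (f (x, ysel x))))))
    {W. \<forall>x\<in>set (x # xs). W x = real_of_ereal (f (x, ysel x))} (length xs + 0)"
    using Cons by (rule runs_bind) (auto intro!: runs_return)
  then show ?case by (simp add: runs_def)
qed (auto simp: runs_def)

text \<open>The threshold takes account of the measuring error: values are never too low and at most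
  \<gamma> too high, so all grid points of true level \<open>\<theta> / 2\<close> pass, and none
  above \<open>\<theta> / 2 + \<gamma>\<close>.\<close>

primrec descend ::
  "nat \<Rightarrow> (point \<Rightarrow> 'x) \<Rightarrow> point set \<Rightarrow> real \<Rightarrow> real \<Rightarrow> real \<Rightarrow> triangle
     \<Rightarrow> (triangle option \<Rightarrow> ('x, 'y) procedure) \<Rightarrow> ('x, 'y) procedure" where
  "descend 0 E D t \<gamma> \<theta> T k = k (Some T)"
| "descend (Suc n) E D t \<gamma> \<theta> T k =
     ask_val (map E (filter (\<lambda>x. x \<in> D) (grid T)))
       (\<lambda>W. case largest_triangle {x\<in>set (grid T) \<inter> D. W (E x) \<le> t + (\<theta> / 2 + \<gamma>)} of
          None \<Rightarrow> k None
        | Some T' \<Rightarrow> descend n E D t \<gamma> (\<theta> / 2 + \<gamma>) T' k)"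

primrec level :: "real \<Rightarrow> nat \<Rightarrow> real \<Rightarrow> real" where
  "level \<gamma> 0 \<theta> = \<theta>"
| "level \<gamma> (Suc n) \<theta> = level \<gamma> n (\<theta> / 2 + \<gamma>)"

text \<open>The map from \<theta> to \<open>\<theta> / 2 + \<gamma>\<close> has the fixed point
  \<open>2 * \<gamma>\<close> and halves the distance to it.\<close>

lemma level_eq: "level \<gamma> n \<theta> = 2 * \<gamma> + (\<theta> - 2 * \<gamma>) / 2 ^ n"
proof (induction n arbitrary: \<theta>)
  case (Suc n)
  show ?case unfolding level.simps Suc.IH by (simp add: field_simps)
qed simp

text \<open>\<open>localizes\<close> is the loop invariant, preserved by
  \<open>localizes_refine\<close>; each round measures at most \<open>grid_count\<close>
  points.\<close>

lemma runs_descend: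
  assumes D: "convex D" "convex_on D H" and C: "C \<subseteq> {q\<in>D. H q \<le> 0}" and "0 \<le> \<gamma>"
    and val: "\<And>x. x \<in> D \<Longrightarrow> t + H x \<le> real_of_ereal (f (E x, ysel (E x)))"
      "\<And>x. x \<in> D \<Longrightarrow> real_of_ereal (f (E x, ysel (E x))) \<le> t + H x + \<gamma>"
  shows "localizes D H C \<theta> T \<Longrightarrow> 0 \<le> \<theta> \<Longrightarrow> runs f g ysel (descend n E D t \<gamma> \<theta> T)
    {r. case r of None \<Rightarrow> C = {} | Some T' \<Rightarrow> localizes D H C (level \<gamma> n \<theta>) T'} (n * grid_count)"
proof (induction n arbitrary: \<theta> T)
  case 0
  then have "Some T \<in> {r. case r of None \<Rightarrow> C = {} | Some T' \<Rightarrow> localizes D H C (level \<gamma> 0 \<theta>) T'}"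
    by simp
  moreover have "descend 0 E D t \<gamma> \<theta> T = (\<lambda>k :: triangle option \<Rightarrow> ('a, 'b) procedure. k (Some T))"
    by (rule ext) simp
  ultimately show ?case using runs_return by metis
next
  case (Suc n)
  let ?R = "{r. case r of None \<Rightarrow> C = {} | Some T' \<Rightarrow> localizes D H C (level \<gamma> (Suc n) \<theta>) T'}"
  have ask: "runs f g ysel (ask_val (map E (filter (\<lambda>x. x \<in> D) (grid T))))
      {W. \<forall>x\<in>set (map E (filter (\<lambda>x. x \<in> D) (grid T))). W x = real_of_ereal (f (x, ysel x))} grid_count"
    using runs_ask_val
  proof (rule runs_weaken)
    show "length (map E (filter (\<lambda>x. x \<in> D) (grid T))) \<le> grid_count"
      unfolding length_map length_grid[of T, symmetric] by (rule length_filter_le)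
  qed simp
  have "runs f g ysel (\<lambda>k. ask_val (map E (filter (\<lambda>x. x \<in> D) (grid T))) (\<lambda>W. (\<lambda>W k.
      case largest_triangle {x\<in>set (grid T) \<inter> D. W (E x) \<le> t + (\<theta> / 2 + \<gamma>)} of
          None \<Rightarrow> k None | Some T' \<Rightarrow> descend n E D t \<gamma> (\<theta> / 2 + \<gamma>) T' k) W k))
    ?R (grid_count + n * grid_count)"
  proof (rule runs_bind[OF ask])
    fix W assume "W \<in> {W. \<forall>x\<in>set (map E (filter (\<lambda>x. x \<in> D) (grid T))). W x = real_of_ereal (f (x, ysel x))}"
    then have W: "W (E x) = real_of_ereal (f (E x, ysel (E x)))" if "x \<in> set (grid T)" "x \<in> D" for x
      using that by (simp only: mem_Collect_eq set_map set_filter ball_simps)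
    let ?A = "{x\<in>set (grid T) \<inter> D. W (E x) \<le> t + (\<theta> / 2 + \<gamma>)}"
    have "case largest_triangle ?A of None \<Rightarrow> C = {} | Some T' \<Rightarrow> localizes D H C (\<theta> / 2 + \<gamma>) T'"
    proof (rule localizes_refine[OF D Suc.prems C])
      show "?A \<subseteq> {x\<in>D. H x \<le> \<theta> / 2 + \<gamma>}" using W val(1) by force
      show "x \<in> ?A" if "x \<in> set (grid T)" "x \<in> D" "H x \<le> \<theta> / 2" for x
        using W[of x] val(2)[of x] that by auto
    qed simp
    then show "runs f g ysel (\<lambda>k. case largest_triangle ?A of
          None \<Rightarrow> k None | Some T' \<Rightarrow> descend n E D t \<gamma> (\<theta> / 2 + \<gamma>) T' k) ?R (n * grid_count)"
      using Suc.IH[of "\<theta> / 2 + \<gamma>"] Suc.prems \<open>0 \<le> \<gamma>\<close>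
      by (cases "largest_triangle ?A") (auto intro: runs_return)
  qed
  then show ?case by simp
qed

section \<open>The searches on a lattice line, on a bundle of lines and in the plane\<close>

definition probe ::
  "(point \<Rightarrow> 'x) \<Rightarrow> real \<Rightarrow> (int \<times> int) list
     \<Rightarrow> ((int \<times> int) option \<Rightarrow> ('x, 'y) procedure) \<Rightarrow> ('x, 'y) procedure" where
  "probe E \<tau> ps k = ask_val (map (\<lambda>p. E (lattice_point p)) ps)
     (\<lambda>W. k (find (\<lambda>p. W (E (lattice_point p)) \<le> \<tau>) ps))"

text \<open>The second coordinate of the strip carries no information: it only makes the triangles
  nondegenerate, so that \<open>descend\<close> also handles a line.\<close>

definition line_search ::
  "nat \<Rightarrow> (point \<Rightarrow> 'x) \<Rightarrow> (int \<times> int) set \<Rightarrow> real \<Rightarrow> real \<Rightarrow> real \<Rightarrow> int \<times> int \<Rightarrow> int \<times> int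
     \<Rightarrow> ((int \<times> int) option \<Rightarrow> ('x, 'y) procedure) \<Rightarrow> ('x, 'y) procedure" where
  "line_search n E P t \<gamma> V b a k =
     (let I = {l. a + multiple l b \<in> P}; lo = Min I; hi = Max I in
      if I = {} then k None
      else if lo = hi then probe E (t + 4 * \<gamma>) [a + multiple lo b] k
      else descend n (\<lambda>x. E (lattice_point a + fst x *\<^sub>R lattice_point b))
             ({of_int lo..of_int hi} \<times> {0..1}) t \<gamma> V
             ((of_int lo, 0), (of_int hi, 0), (of_int lo, 1))
             (\<lambda>r. case r of None \<Rightarrow> k None | Some (x, y, z) \<Rightarrow>
                let J = {l. \<exists>x'\<in>{x, y, z}. \<exists>y'\<in>{x, y, z}. fst x' \<le> of_int l \<and> of_int l \<le> fst y'} in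
                if J \<noteq> {} then k (Some (a + multiple (SOME l. l \<in> J) b))
                else probe E (t + 4 * \<gamma>)
                  (map (\<lambda>l. a + multiple l b)
                    (filter (\<lambda>l. l \<in> I) [\<lfloor>fst x\<rfloor> - 4..\<lfloor>fst x\<rfloor> + 5])) k))"

primrec scan ::
  "nat \<Rightarrow> (point \<Rightarrow> 'x) \<Rightarrow> (int \<times> int) set \<Rightarrow> real \<Rightarrow> real \<Rightarrow> real \<Rightarrow> int \<times> int \<Rightarrow> (int \<times> int) list
     \<Rightarrow> ((int \<times> int) option \<Rightarrow> ('x, 'y) procedure) \<Rightarrow> ('x, 'y) procedure" where
  "scan n E P t \<gamma> V b [] k = k None"
| "scan n E P t \<gamma> V b (a # as) k =
     line_search n E P t \<gamma> V b a
       (\<lambda>r. case r of None \<Rightarrow> scan n E P t \<gamma> V b as k | Some p \<Rightarrow> k (Some p))"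

text \<open>The first condition makes \<open>b\<close> and \<open>a\<close> a lattice basis; the
  second puts \<open>X\<close> on 98 consecutive lattice lines parallel to \<open>b\<close>.\<close>

definition thin_direction :: "(int \<times> int) set \<Rightarrow> (int \<times> int) \<times> (int \<times> int) \<times> int \<Rightarrow> bool" where
  "thin_direction X = (\<lambda>(b, a, m). icross b a = 1 \<and> icross b ` X \<subseteq> {m..m + 97})"

text \<open>The direction is chosen from \<open>X\<close> alone, which is known by then, so the
  choice costs no evaluation.\<close>

definition scan_thin ::
  "nat \<Rightarrow> (point \<Rightarrow> 'x) \<Rightarrow> (int \<times> int) set \<Rightarrow> real \<Rightarrow> real \<Rightarrow> real \<Rightarrow> (int \<times> int) set
     \<Rightarrow> ((int \<times> int) option \<Rightarrow> ('x, 'y) procedure) \<Rightarrow> ('x, 'y) procedure" where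
  "scan_thin n E P t \<gamma> V X =
     (case (SOME d. thin_direction X d) of (b, a, m) \<Rightarrow>
        scan n E P t \<gamma> V b (map (\<lambda>j. multiple j a) [m..m + 97]))"

text \<open>The region to which \<open>localizes\<close> confines the candidates.\<close>

fun near_triangle :: "triangle \<Rightarrow> point set" where
  "near_triangle (a, b, c) =
     {q. \<bar>cross (q - a) (c - a)\<bar> \<le> 2 * \<bar>cross (b - a) (c - a)\<bar> \<and>
         \<bar>cross (b - a) (q - a)\<bar> \<le> 2 * \<bar>cross (b - a) (c - a)\<bar>}"

fun solid_triangle :: "triangle \<Rightarrow> point set" where
  "solid_triangle (a, b, c) =
     {a + s *\<^sub>R (b - a) + r *\<^sub>R (c - a) |s r. 0 \<le> s \<and> 0 \<le> r \<and> s + r \<le> 1}"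

text \<open>A lattice point of the final triangle is returned unmeasured, since convexity bounds its
  level by that of the vertices.\<close>

definition plane_search ::
  "nat \<Rightarrow> (point \<Rightarrow> 'x) \<Rightarrow> (int \<times> int) set \<Rightarrow> real \<Rightarrow> real \<Rightarrow> real
     \<Rightarrow> ((int \<times> int) option \<Rightarrow> ('x, 'y) procedure) \<Rightarrow> ('x, 'y) procedure" where
  "plane_search n E P t \<gamma> V k =
     (case largest_triangle (lattice_point ` P) of
        None \<Rightarrow> scan_thin n E P t \<gamma> V P k
      | Some T \<Rightarrow> descend n E (convex hull (lattice_point ` P)) t \<gamma> V T
          (\<lambda>r. case r of None \<Rightarrow> k None | Some T' \<Rightarrow>
             if \<exists>p. lattice_point p \<in> solid_triangle T'
             then k (Some (SOME p. lattice_point p \<in> solid_triangle T'))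
             else scan_thin n E P t \<gamma> V {p\<in>P. lattice_point p \<in> near_triangle T'} k))"

section \<open>Correctness and cost of the search\<close>

lemma localizes_mono: "localizes D H C \<theta> T \<Longrightarrow> \<theta> \<le> \<theta>' \<Longrightarrow> localizes D H C \<theta>' T"
  unfolding localizes_def by (cases T) auto

text \<open>\<open>F\<close> plays the part of \<phi> in the plane, known only with a one-sided
  error \<gamma>. By \<open>closed_P\<close>, every lattice point met in the hull is
  admissible.\<close>

locale noisy_values =
  fixes f :: "'x::real_vector \<times> 'y \<Rightarrow> ereal" and g :: "'x \<Rightarrow> real" and ysel :: "'x \<Rightarrow> 'y"
    and E :: "point \<Rightarrow> 'x" and P :: "(int \<times> int) set" and F :: "point \<Rightarrow> real"
    and t \<gamma> V :: real and n :: nat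
  assumes finite_P: "finite P"
    and closed_P: "\<And>p. lattice_point p \<in> convex hull (lattice_point ` P) \<Longrightarrow> p \<in> P"
    and convex_F: "convex_on (convex hull (lattice_point ` P)) F"
    and val_ge: "\<And>x. x \<in> convex hull (lattice_point ` P) \<Longrightarrow>
      F x \<le> real_of_ereal (f (E x, ysel (E x)))"
    and val_le: "\<And>x. x \<in> convex hull (lattice_point ` P) \<Longrightarrow>
      real_of_ereal (f (E x, ysel (E x))) \<le> F x + \<gamma>"
    and F_le: "\<And>x. x \<in> convex hull (lattice_point ` P) \<Longrightarrow> F x \<le> t + V"
    and \<gamma>_pos: "0 < \<gamma>" and V_pos: "0 < V"
    and rounds: "V \<le> \<gamma> * 2 ^ n"
begin

abbreviation "D \<equiv> convex hull (lattice_point ` P)"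

text \<open>\<open>4 * \<gamma>\<close> is the final level \<open>3 * \<gamma>\<close> plus one
  measuring error.\<close>

definition good :: "(int \<times> int) set" where
  "good = {p\<in>P. real_of_ereal (f (E (lattice_point p), ysel (E (lattice_point p)))) \<le> t + 4 * \<gamma>}"

definition candidates :: "(int \<times> int) set" where
  "candidates = {p\<in>P. F (lattice_point p) \<le> t}"

text \<open>\<open>X\<close> limits only what \<open>None\<close> claims. A returned point may lie
  elsewhere, so any hit in a partial search settles the whole search.\<close>

definition answers :: "(int \<times> int) set \<Rightarrow> (int \<times> int) option set" where
  "answers X = {r. case r of None \<Rightarrow> candidates \<inter> X = {} | Some p \<Rightarrow> p \<in> good}"

lemma convex_D: "convex D"
  by (rule convex_convex_hull)

lemma mem_D: "p \<in> P \<Longrightarrow> lattice_point p \<in> D"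
  by (simp add: hull_inc)

text \<open>The number of rounds is chosen so that the excess over the fixed point
  \<open>2 * \<gamma>\<close> drops to \<gamma> or less.\<close>

lemma level_le: "level \<gamma> n V \<le> 3 * \<gamma>"
proof -
  have "(V - 2 * \<gamma>) / 2 ^ n \<le> \<gamma>"
  proof (subst pos_divide_le_eq)
    show "V - 2 * \<gamma> \<le> \<gamma> * 2 ^ n" using rounds \<gamma>_pos by linarith
  qed simp
  then show ?thesis unfolding level_eq by simp
qed

lemma goodI:
  assumes "lattice_point p \<in> D" "F (lattice_point p) \<le> t + 3 * \<gamma>"
  shows "p \<in> good"
  using assms(2) closed_P[OF assms(1)] val_le[OF assms(1)] unfolding good_def by simp

lemma runs_probe:
  assumes "set ps \<subseteq> P"
  shows "runs f g ysel (probe E (t + 4 * \<gamma>) ps) (answers (set ps)) (length ps)"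
proof -
  let ?W = "\<lambda>p. real_of_ereal (f (E (lattice_point p), ysel (E (lattice_point p))))"
  have ask: "runs f g ysel (ask_val (map (\<lambda>p. E (lattice_point p)) ps))
      {W. \<forall>x\<in>set (map (\<lambda>p. E (lattice_point p)) ps). W x = real_of_ereal (f (x, ysel x))} (length ps)"
    using runs_ask_val[of f g ysel "map (\<lambda>p. E (lattice_point p)) ps"] by (simp only: length_map)
  have "runs f g ysel (\<lambda>k. ask_val (map (\<lambda>p. E (lattice_point p)) ps)
     (\<lambda>W. k (find (\<lambda>p. W (E (lattice_point p)) \<le> t + 4 * \<gamma>) ps))) (answers (set ps)) (length ps + 0)"
  proof (rule runs_bind[OF ask])
    fix W assume "W \<in> {W. \<forall>x\<in>set (map (\<lambda>p. E (lattice_point p)) ps). W x = real_of_ereal (f (x, ysel x))}"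
    then have W: "W (E (lattice_point p)) = ?W p" if "p \<in> set ps" for p
      using that by (simp only: mem_Collect_eq set_map ball_simps)
    have "find (\<lambda>p. W (E (lattice_point p)) \<le> t + 4 * \<gamma>) ps \<in> answers (set ps)"
    proof (cases "find (\<lambda>p. W (E (lattice_point p)) \<le> t + 4 * \<gamma>) ps")
      case None
      \<comment> \<open>A candidate would measure at most \<open>t + \<gamma>\<close>, below the
        threshold.\<close>
      have "F (lattice_point p) > t" if "p \<in> set ps" for p
      proof -
        have "\<not> W (E (lattice_point p)) \<le> t + 4 * \<gamma>"
          using None that unfolding find_None_iff by blast
        moreover have "lattice_point p \<in> D" using mem_D assms that by blast
        ultimately show ?thesis using W[OF that] val_le[of "lattice_point p"] \<gamma>_pos by linarith
      qed
      then have "candidates \<inter> set ps = {}" unfolding candidates_def by fastforce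
      then show ?thesis using None unfolding answers_def by simp
    next
      case (Some p)
      then have "p \<in> set ps" "W (E (lattice_point p)) \<le> t + 4 * \<gamma>"
        by (auto simp: find_Some_iff)
      then show ?thesis using Some W assms by (auto simp: answers_def good_def)
    qed
    then show "runs f g ysel (\<lambda>k. k (find (\<lambda>p. W (E (lattice_point p)) \<le> t + 4 * \<gamma>) ps)) (answers (set ps)) 0"
      by (rule runs_return)
  qed
  then show ?thesis unfolding probe_def by simp
qed

lemma lattice_line: "lattice_point (a + multiple l b) = lattice_point a + of_int l *\<^sub>R lattice_point b"
  by (simp add: lattice_point_add lattice_point_multiple)

lemma finite_line_indices:
  assumes "b \<noteq> 0"
  shows "finite {l. a + multiple l b \<in> P}"
proof (rule finite_imageD)
  show "finite ((\<lambda>l. a + multiple l b) ` {l. a + multiple l b \<in> P})"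
    by (rule finite_subset[OF _ finite_P]) auto
  show "inj_on (\<lambda>l. a + multiple l b) {l. a + multiple l b \<in> P}"
    using assms by (auto simp: inj_on_def multiple_def zero_prod_def prod_eq_iff)
qed

text \<open>If an integer lies between the first coordinates of two vertices of the final triangle,
  convexity gives a good point. Otherwise the triangle is less than one unit long along the line,
  and the candidates are confined to ten positions.\<close>

lemma runs_line_search:
  assumes b: "b \<noteq> 0"
  shows "runs f g ysel (line_search n E P t \<gamma> V b a) (answers {a + multiple l b | l. True})
    (n * grid_count + 10)"
proof -
  define I where "I = {l. a + multiple l b \<in> P}"
  define lo where "lo = Min I"
  define hi where "hi = Max I"
  let ?L = "{a + multiple l b | l. True}"
  let ?E = "\<lambda>x. lattice_point a + fst x *\<^sub>R lattice_point b"
  let ?D = "{real_of_int lo..of_int hi} \<times> {0..1::real}"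
  let ?H = "\<lambda>x. F (?E x) - t"
  let ?C = "{(of_int l, 0) | l. a + multiple l b \<in> candidates}"
  have "finite I" unfolding I_def by (rule finite_line_indices[OF b])
  have cand: "r \<in> answers ?L" if "r \<in> answers ((\<lambda>l. a + multiple l b) ` J)"
    "\<And>l. a + multiple l b \<in> candidates \<Longrightarrow> l \<in> J" for r J
    using that unfolding answers_def by (auto split: option.splits)
  note unf = line_search_def Let_def I_def[symmetric] lo_def[symmetric] hi_def[symmetric]
  consider "I = {}" | "I \<noteq> {}" "lo = hi" | "I \<noteq> {}" "lo \<noteq> hi" by blast
  then show ?thesis
  proof cases
    case 1
    then have "None \<in> answers ?L" by (auto simp: answers_def candidates_def I_def)
    then show ?thesis unfolding unf using 1 by (simp add: runs_return)
  next
    \<comment> \<open>A single position would make the starting triangle degenerate, so it is probed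
      directly.\<close>
    case 2
    have I1: "l = lo" if "l \<in> I" for l
      using Min_le[OF \<open>finite I\<close> that] Max_ge[OF \<open>finite I\<close> that] 2(2) unfolding lo_def hi_def by simp
    have "lo \<in> I" using Min_in[OF \<open>finite I\<close> 2(1)] unfolding lo_def .
    then have "runs f g ysel (probe E (t + 4 * \<gamma>) [a + multiple lo b]) (answers {a + multiple lo b}) 1"
      using runs_probe[of "[a + multiple lo b]"] by (simp add: I_def)
    then have "runs f g ysel (probe E (t + 4 * \<gamma>) [a + multiple lo b]) (answers ?L) (n * grid_count + 10)"
    proof (rule runs_weaken)
      show "answers {a + multiple lo b} \<subseteq> answers ?L"
        using cand[of _ "{lo}"] I1 by (auto simp: I_def candidates_def)
    qed simp
    then show ?thesis unfolding unf using 2 by simp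
  next
    case 3
    have lohi: "lo \<in> I" "hi \<in> I" using Min_in[OF \<open>finite I\<close> 3(1)] Max_in[OF \<open>finite I\<close> 3(1)]
      unfolding lo_def hi_def by auto
    have I_le: "lo \<le> l \<and> l \<le> hi" if "l \<in> I" for l
      unfolding lo_def hi_def using that \<open>finite I\<close> by simp
    have lt: "lo < hi" using 3(2) I_le[OF lohi(1)] by simp
    \<comment> \<open>The strip is mapped onto the segment between the two extreme points of
      \<open>P\<close> on the line.\<close>
    have ED: "?E x \<in> D" if "x \<in> ?D" for x
    proof -
      define \<mu> where "\<mu> = (fst x - of_int lo) / (of_int hi - of_int lo)"
      have \<mu>: "0 \<le> \<mu>" "\<mu> \<le> 1" using that lt unfolding \<mu>_def by (auto simp: field_simps)
      have "\<mu> * (of_int hi - of_int lo) = fst x - of_int lo"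
        using lt unfolding \<mu>_def by simp
      then have fst_x: "fst x = (1 - \<mu>) * of_int lo + \<mu> * of_int hi"
        by (simp add: algebra_simps)
      have "?E x = (1 - \<mu>) *\<^sub>R lattice_point (a + multiple lo b) + \<mu> *\<^sub>R lattice_point (a + multiple hi b)"
        unfolding lattice_line fst_x by (simp add: algebra_simps)
      then show ?thesis
        using convexD_alt[OF convex_D mem_D mem_D, of "a + multiple lo b" "a + multiple hi b" \<mu>] lohi \<mu>
        by (simp add: I_def)
    qed
    have convex_strip: "convex ?D" by (intro convex_Times convex_real_interval)
    have convex_H: "convex_on ?D ?H"
    proof (rule convex_onI[OF _ convex_strip])
      fix s :: real and x y assume s: "0 < s" "s < 1" and xy: "x \<in> ?D" "y \<in> ?D"
      have "?E ((1 - s) *\<^sub>R x + s *\<^sub>R y) = (1 - s) *\<^sub>R ?E x + s *\<^sub>R ?E y"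
        by (simp add: algebra_simps)
      then show "?H ((1 - s) *\<^sub>R x + s *\<^sub>R y) \<le> (1 - s) * ?H x + s * ?H y"
        using convex_onD[OF convex_F, of s "?E x" "?E y"] ED[OF xy(1)] ED[OF xy(2)] s
        by (simp add: algebra_simps)
    qed
    have C_D: "?C \<subseteq> {q\<in>?D. ?H q \<le> 0}"
      using I_le by (auto simp: candidates_def I_def lattice_line)
    have H_le: "?H x \<le> V" if "x \<in> ?D" for x using F_le[OF ED[OF that]] by simp
    have start: "localizes ?D ?H ?C V ((of_int lo, 0), (of_int hi, 0), (of_int lo, 1))"
    proof -
      have "\<bar>real_of_int l - of_int lo\<bar> \<le> 2 * \<bar>of_int hi - of_int lo\<bar>" if "a + multiple l b \<in> candidates" for l
        using I_le[of l] that by (simp add: candidates_def I_def)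
      then show ?thesis
        unfolding localizes_def
        using lt H_le[of "(of_int lo, 0)"] H_le[of "(of_int hi, 0)"] H_le[of "(of_int lo, 1)"]
        by (auto simp: cross_def)
    qed
    let ?m = "\<lambda>x. [\<lfloor>fst x\<rfloor> - 4..\<lfloor>fst x\<rfloor> + 5]"
    let ?J = "\<lambda>x y z. {l. \<exists>x'\<in>{x, y, z}. \<exists>y'\<in>{x, y, z}. fst x' \<le> real_of_int l \<and> of_int l \<le> fst y'}"
    have "runs f g ysel (\<lambda>k. descend n (\<lambda>x. E (?E x)) ?D t \<gamma> V
             ((of_int lo, 0), (of_int hi, 0), (of_int lo, 1))
             (\<lambda>r. (\<lambda>r k. case r of None \<Rightarrow> k None | Some (x, y, z) \<Rightarrow>
                if ?J x y z \<noteq> {} then k (Some (a + multiple (SOME l. l \<in> ?J x y z) b))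
                else probe E (t + 4 * \<gamma>)
                  (map (\<lambda>l. a + multiple l b) (filter (\<lambda>l. l \<in> I) (?m x))) k) r k))
          (answers ?L) (n * grid_count + 10)"
    proof (rule runs_bind[OF runs_descend[OF convex_strip convex_H C_D _ _ _ start]])
      fix r assume r: "r \<in> {r. case r of None \<Rightarrow> ?C = {} | Some T' \<Rightarrow> localizes ?D ?H ?C (level \<gamma> n V) T'}"
      show "runs f g ysel (\<lambda>k. case r of None \<Rightarrow> k None | Some (x, y, z) \<Rightarrow>
                if ?J x y z \<noteq> {} then k (Some (a + multiple (SOME l. l \<in> ?J x y z) b))
                else probe E (t + 4 * \<gamma>)
                  (map (\<lambda>l. a + multiple l b) (filter (\<lambda>l. l \<in> I) (?m x))) k) (answers ?L) 10"
      proof (cases r)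
        case None
        then have "None \<in> answers ?L" using r by (auto simp: answers_def)
        then show ?thesis using None by (simp add: runs_return)
      next
        case (Some T)
        obtain x y z where T: "T = (x, y, z)" by (cases T)
        have xyz: "x \<in> ?D" "y \<in> ?D" "z \<in> ?D" "cross (y - x) (z - x) \<noteq> 0"
          "?H x \<le> 3 * \<gamma>" "?H y \<le> 3 * \<gamma>" "?H z \<le> 3 * \<gamma>"
          and near: "\<And>q. q \<in> ?C \<Longrightarrow> \<bar>cross (q - x) (z - x)\<bar> \<le> 2 * \<bar>cross (y - x) (z - x)\<bar>"
          "\<And>q. q \<in> ?C \<Longrightarrow> \<bar>cross (y - x) (q - x)\<bar> \<le> 2 * \<bar>cross (y - x) (z - x)\<bar>"
        proof -
          have "localizes ?D ?H ?C (level \<gamma> n V) (x, y, z)"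
            using r unfolding Some T by (simp only: mem_Collect_eq option.case)
          from localizes_mono[OF this level_le]
          have "x \<in> ?D \<and> y \<in> ?D \<and> z \<in> ?D \<and> cross (y - x) (z - x) \<noteq> 0 \<and>
            ?H x \<le> 3 * \<gamma> \<and> ?H y \<le> 3 * \<gamma> \<and> ?H z \<le> 3 * \<gamma> \<and>
            (\<forall>q\<in>?C. \<bar>cross (q - x) (z - x)\<bar> \<le> 2 * \<bar>cross (y - x) (z - x)\<bar> \<and>
             \<bar>cross (y - x) (q - x)\<bar> \<le> 2 * \<bar>cross (y - x) (z - x)\<bar>)"
            unfolding localizes_def prod.case .
          then show "x \<in> ?D" "y \<in> ?D" "z \<in> ?D" "cross (y - x) (z - x) \<noteq> 0"
            "?H x \<le> 3 * \<gamma>" "?H y \<le> 3 * \<gamma>" "?H z \<le> 3 * \<gamma>"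
            "\<And>q. q \<in> ?C \<Longrightarrow> \<bar>cross (q - x) (z - x)\<bar> \<le> 2 * \<bar>cross (y - x) (z - x)\<bar>"
            "\<And>q. q \<in> ?C \<Longrightarrow> \<bar>cross (y - x) (q - x)\<bar> \<le> 2 * \<bar>cross (y - x) (z - x)\<bar>"
            by (blast, blast, blast, blast, blast, blast, blast, blast, blast)
        qed
        define J where "J = ?J x y z"
        have run_eq: "(\<lambda>k. case r of None \<Rightarrow> k None | Some (x, y, z) \<Rightarrow>
                if ?J x y z \<noteq> {} then k (Some (a + multiple (SOME l. l \<in> ?J x y z) b))
                else probe E (t + 4 * \<gamma>)
                  (map (\<lambda>l. a + multiple l b) (filter (\<lambda>l. l \<in> I) (?m x))) k) =
            (\<lambda>k. if J \<noteq> {} then k (Some (a + multiple (SOME l. l \<in> J) b))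
                else probe E (t + 4 * \<gamma>)
                  (map (\<lambda>l. a + multiple l b) (filter (\<lambda>l. l \<in> I) (?m x))) k)"
          unfolding Some T option.case prod.case J_def ..
        show ?thesis
        proof (cases "J = {}")
          case False
          define l where "l = (SOME l. l \<in> J)"
          have "l \<in> J" unfolding l_def using False by (rule some_in_eq[THEN iffD2])
          then obtain x' y' where x'y': "x' \<in> {x, y, z}" "y' \<in> {x, y, z}" "fst x' \<le> of_int l" "of_int l \<le> fst y'"
            unfolding J_def by blast
          have "v \<in> ?D \<and> ?H v \<le> 3 * \<gamma>" if "v \<in> {x, y, z}" for v
            using that xyz by blast
          then have D': "x' \<in> ?D" "y' \<in> ?D" "?H x' \<le> 3 * \<gamma>" "?H y' \<le> 3 * \<gamma>"
            using x'y'(1,2) by blast+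
          obtain \<mu> where \<mu>: "0 \<le> \<mu>" "\<mu> \<le> 1" "of_int l = (1 - \<mu>) * fst x' + \<mu> * fst y'"
          proof -
            have "of_int l \<in> closed_segment (fst x') (fst y')"
              using x'y'(3,4) by (simp add: closed_segment_eq_real_ivl)
            then show ?thesis using that by (auto simp: in_segment)
          qed
          \<comment> \<open>\<open>?E\<close> ignores the second coordinate, so a point of the strip
            with first coordinate \<open>l\<close> is mapped to the lattice point.\<close>
          define p where "p = (1 - \<mu>) *\<^sub>R x' + \<mu> *\<^sub>R y'"
          have p: "p \<in> ?D" unfolding p_def
            using convexD_alt[OF convex_strip D'(1,2)] \<mu> by blast
          have "?H p \<le> (1 - \<mu>) * ?H x' + \<mu> * ?H y'"
            unfolding p_def using convex_onD[OF convex_H _ _ D'(1,2)] \<mu> by blast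
          also have "\<dots> \<le> (1 - \<mu>) * (3 * \<gamma>) + \<mu> * (3 * \<gamma>)"
            using \<mu> D' by (intro add_mono mult_left_mono) auto
          finally have "?H p \<le> 3 * \<gamma>" by (simp add: algebra_simps)
          moreover have "?E p = lattice_point (a + multiple l b)"
            unfolding lattice_line p_def \<mu>(3) by simp
          ultimately have "a + multiple l b \<in> good"
            using ED[OF p] by (intro goodI) auto
          then have "Some (a + multiple l b) \<in> answers ?L" by (simp add: answers_def)
          then have "runs f g ysel (\<lambda>k. k (Some (a + multiple l b))) (answers ?L) 10"
            by (rule runs_return)
          then show ?thesis unfolding run_eq l_def by (simp only: False if_True not_False_eq_True)
        next
          case True
          have no: "\<not> (fst x' \<le> real_of_int l \<and> of_int l \<le> fst y')"
            if "x' \<in> {x, y, z}" "y' \<in> {x, y, z}" for x' y' l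
            using True that unfolding J_def by blast
          define m where "m = \<lfloor>fst x\<rfloor>"
          have mx: "of_int m \<le> fst x" "fst x < of_int m + 1" unfolding m_def by linarith+
          \<comment> \<open>Neither \<open>m\<close> nor \<open>m + 1\<close> separates the
            vertices, so all first coordinates lie between these two integers.\<close>
          have close: "\<bar>fst v - fst x\<bar> \<le> 1" if "v \<in> {x, y, z}" for v
            using no[of v x m] no[of x v "m + 1"] that mx by force
          \<comment> \<open>Two coordinates of size at most 2, times edges of extent at most 1, give
            distance at most 4 from \<open>fst x\<close>.\<close>
          have "l \<in> set (?m x) \<inter> I" if l: "a + multiple l b \<in> candidates" for l
          proof -
            let ?q = "(real_of_int l, 0::real)"
            have q: "?q \<in> ?C" using l by blast
            define \<alpha> \<beta> where "\<alpha> = cross (?q - x) (z - x) / cross (y - x) (z - x)"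
              and "\<beta> = cross (y - x) (?q - x) / cross (y - x) (z - x)"
            have "\<bar>\<alpha>\<bar> \<le> 2" "\<bar>\<beta>\<bar> \<le> 2"
              unfolding \<alpha>_def \<beta>_def using near[OF q] xyz(4) by (auto simp: field_simps)
            moreover have "of_int l - fst x = \<alpha> * (fst y - fst x) + \<beta> * (fst z - fst x)"
              using arg_cong[OF cross_coords[OF xyz(4), of "?q - x"], of fst] unfolding \<alpha>_def \<beta>_def by simp
            moreover have "\<bar>\<alpha> * (fst y - fst x)\<bar> \<le> 2 * 1" "\<bar>\<beta> * (fst z - fst x)\<bar> \<le> 2 * 1"
              unfolding abs_mult using close calculation by (intro mult_mono; simp)+
            ultimately have "\<bar>of_int l - fst x\<bar> \<le> 4" by linarith
            then have "m - 4 \<le> l" "l \<le> m + 5" using mx by linarith+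
            then show ?thesis using l by (simp add: m_def I_def candidates_def)
          qed
          then have "answers ((\<lambda>l. a + multiple l b) ` (set (?m x) \<inter> I)) \<subseteq> answers ?L"
            using cand by blast
          moreover have "length (filter (\<lambda>l. l \<in> I) (?m x)) \<le> 10"
            by (rule order_trans[OF length_filter_le]) simp
          moreover have "set (filter (\<lambda>l. l \<in> I) (?m x)) = set (?m x) \<inter> I" by auto
          ultimately have "runs f g ysel (probe E (t + 4 * \<gamma>) (map (\<lambda>l. a + multiple l b) (filter (\<lambda>l. l \<in> I) (?m x)))) (answers ?L) 10"
            using runs_probe[of "map (\<lambda>l. a + multiple l b) (filter (\<lambda>l. l \<in> I) (?m x))"]
            by (intro runs_weaken[OF runs_probe]) (auto simp: I_def)
          then show ?thesis unfolding run_eq by (simp only: True if_False not_True_eq_False simp_thms)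
        qed
      qed
    next
      fix x assume "x \<in> ?D"
      then show "t + ?H x \<le> real_of_ereal (f (E (?E x), ysel (E (?E x))))"
        "real_of_ereal (f (E (?E x), ysel (E (?E x)))) \<le> t + ?H x + \<gamma>"
        using val_ge[OF ED] val_le[OF ED] by simp_all
    qed (use \<gamma>_pos V_pos in auto)
    then show ?thesis unfolding unf by (simp only: 3 if_False)
  qed
qed

end

section \<open>Existence of thin directions\<close>

lemma thin_direction_collinear:
  assumes "largest_triangle (lattice_point ` P) = None"
  shows "\<exists>d. thin_direction P d"
proof -
  have collinear: "icross (q - p) (r - p) = 0" if "p \<in> P" "q \<in> P" "r \<in> P" for p q r
  proof -
    have "cross (lattice_point q - lattice_point p) (lattice_point r - lattice_point p) = 0"
      using largest_triangle_None[OF assms] that by blast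
    moreover have "lattice_point q - lattice_point p = lattice_point (q - p)"
      "lattice_point r - lattice_point p = lattice_point (r - p)"
      by (simp_all add: lattice_point_def)
    ultimately show ?thesis by (simp add: cross_lattice_point)
  qed
  show ?thesis
  proof (cases "\<exists>p\<in>P. \<exists>q\<in>P. p \<noteq> q")
    case True
    then obtain p q where pq: "p \<in> P" "q \<in> P" "p \<noteq> q" by blast
    define d where "d = gcd (fst (q - p)) (snd (q - p))"
    have "d \<noteq> 0" using pq(3) unfolding d_def by (auto simp: prod_eq_iff)
    define b where "b = (fst (q - p) div d, snd (q - p) div d)"
    have qp: "q - p = multiple d b"
      unfolding b_def multiple_def d_def by (simp add: prod_eq_iff)
    have "coprime (fst b) (snd b)"
      using \<open>d \<noteq> 0\<close> unfolding b_def d_def by (auto intro!: div_gcd_coprime)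
    then obtain a where a: "icross b a = 1" using icross_unit_exists by blast
    \<comment> \<open>Collinearity puts all of \<open>P\<close> on one line parallel to the
      primitive vector \<open>b\<close> of the difference \<open>q - p\<close>.\<close>
    have "icross b r = icross b p" if "r \<in> P" for r
    proof -
      have "d * icross b (r - p) = icross (multiple d b) (r - p)"
        by (simp add: icross_def multiple_def algebra_simps)
      also have "\<dots> = 0" using collinear[OF pq(1,2) that] qp by simp
      finally have "icross b (r - p) = 0" using \<open>d \<noteq> 0\<close> by simp
      then show ?thesis by (simp add: icross_def algebra_simps)
    qed
    then have "thin_direction P (b, a, icross b p)"
      using a unfolding thin_direction_def by auto
    then show ?thesis by blast
  next
    case False
    then obtain p where "P \<subseteq> {p}" by blast
    then have "thin_direction P ((1, 0), (0, 1), icross (1, 0) p)"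
      unfolding thin_direction_def by (auto simp: icross_def)
    then show ?thesis by blast
  qed
qed

text \<open>In the flat direction both edges have width at most 12; coordinates up to 2 enlarge this
  by a bounded factor only.\<close>

lemma thin_direction_lattice_free:
  assumes nondeg: "cross (b - a) (c - a) \<noteq> 0"
    and free: "\<And>p. lattice_point p \<notin> solid_triangle (a, b, c)"
  shows "\<exists>d. thin_direction {p\<in>P. lattice_point p \<in> near_triangle (a, b, c)} d"
proof -
  define u where "u = b - a"
  define w where "w = c - a"
  have uw: "cross u w \<noteq> 0" using nondeg by (simp add: u_def w_def)
  have "lattice_point p \<noteq> a + s *\<^sub>R u + r *\<^sub>R w" if "0 \<le> s" "0 \<le> r" "s + r \<le> 1" for p s r
    using free[of p] that unfolding solid_triangle.simps u_def w_def by blast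
  then obtain v where v: "coprime (fst v) (snd v)"
    "\<bar>cross (lattice_point v) u\<bar> \<le> 12" "\<bar>cross (lattice_point v) w\<bar> \<le> 12"
    using flat_lattice_free_triangle[OF uw] by metis
  then obtain v' where v': "icross v v' = 1" using icross_unit_exists by blast
  \<comment> \<open>48 = 2 * 12 + 2 * 12 bounds the deviation from \<open>a\<close> on either side.
    The extra unit in 97 = 2 * 48 + 1 absorbs the rounding.\<close>
  define m where "m = \<lfloor>cross (lattice_point v) a\<rfloor> - 48"
  have "icross v p \<in> {m..m + 97}" if "lattice_point p \<in> near_triangle (a, b, c)" for p
  proof -
    let ?q = "lattice_point p - a"
    define \<alpha> \<beta> where "\<alpha> = cross ?q w / cross u w" and "\<beta> = cross u ?q / cross u w"
    have ab: "\<bar>\<alpha>\<bar> \<le> 2" "\<bar>\<beta>\<bar> \<le> 2"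
      using that uw unfolding \<alpha>_def \<beta>_def by (auto simp: u_def w_def field_simps)
    have "cross (lattice_point v) ?q = cross (lattice_point v) (\<alpha> *\<^sub>R u + \<beta> *\<^sub>R w)"
      using cross_coords[OF uw, of ?q] unfolding \<alpha>_def \<beta>_def by simp
    also have "\<dots> = \<alpha> * cross (lattice_point v) u + \<beta> * cross (lattice_point v) w"
      by (simp only: cross_simps)
    finally have "real_of_int (icross v p) = cross (lattice_point v) a
        + \<alpha> * cross (lattice_point v) u + \<beta> * cross (lattice_point v) w"
      by (simp add: cross_simps flip: cross_lattice_point)
    moreover have "\<bar>\<alpha> * cross (lattice_point v) u\<bar> \<le> 2 * 12" "\<bar>\<beta> * cross (lattice_point v) w\<bar> \<le> 2 * 12"
      unfolding abs_mult using ab v by (intro mult_mono; simp)+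
    ultimately have "\<bar>real_of_int (icross v p) - cross (lattice_point v) a\<bar> \<le> 48" by linarith
    then show ?thesis unfolding m_def atLeastAtMost_iff by linarith
  qed
  then have "thin_direction {p\<in>P. lattice_point p \<in> near_triangle (a, b, c)} (v, v', m)"
    using v' unfolding thin_direction_def by auto
  then show ?thesis by blast
qed

text \<open>Cramer's rule over the integers, with determinant 1. The line containing
  \<open>p\<close> is read off from \<open>icross b p\<close>.\<close>

lemma lattice_basis_expansion:
  assumes "icross b a = 1"
  shows "p = multiple (icross b p) a + multiple (icross p a) b"
proof -
  have 1: "fst b * snd a = 1 + snd b * fst a" using assms by (simp add: icross_def)
  have "fst p = (fst b * snd a - snd b * fst a) * fst p"
    "snd p = (fst b * snd a - snd b * fst a) * snd p"
    using 1 by simp_all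
  then show ?thesis
    by (simp add: icross_def multiple_def prod_eq_iff algebra_simps)
qed

section \<open>Scanning a bundle of lines and searching the plane\<close>

context noisy_values
begin

lemma answers_mono: "candidates \<inter> Y \<subseteq> X \<Longrightarrow> answers X \<subseteq> answers Y"
  unfolding answers_def by (auto split: option.splits) blast

lemma runs_scan:
  assumes b: "b \<noteq> 0"
  shows "runs f g ysel (scan n E P t \<gamma> V b as)
    (answers (\<Union>a\<in>set as. {a + multiple l b | l. True})) (length as * (n * grid_count + 10))"
proof (induction as)
  case Nil
  have "None \<in> answers (\<Union>a\<in>set []. {a + multiple l b | l. True})" by (simp add: answers_def)
  then have "runs f g ysel (\<lambda>k. k None) (answers (\<Union>a\<in>set []. {a + multiple l b | l. True}))
     (length [] * (n * grid_count + 10))" by (rule runs_return)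
  then show ?case by simp
next
  case (Cons a as)
  let ?L = "\<lambda>a. {a + multiple l b | l. True}"
  let ?R = "answers (\<Union>a\<in>set (a # as). ?L a)"
  have "runs f g ysel (\<lambda>k. line_search n E P t \<gamma> V b a
       (\<lambda>r. (\<lambda>r k. case r of None \<Rightarrow> scan n E P t \<gamma> V b as k | Some p \<Rightarrow> k (Some p)) r k)) ?R
       ((n * grid_count + 10) + length as * (n * grid_count + 10))"
  proof (rule runs_bind[OF runs_line_search[OF b]])
    fix r assume r: "r \<in> answers (?L a)"
    show "runs f g ysel (\<lambda>k. case r of None \<Rightarrow> scan n E P t \<gamma> V b as k | Some p \<Rightarrow> k (Some p)) ?R
       (length as * (n * grid_count + 10))"
    proof (cases r)
      case None
      then have "candidates \<inter> ?L a = {}" using r unfolding answers_def by simp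
      then have "answers (\<Union>a\<in>set as. ?L a) \<subseteq> ?R" by (intro answers_mono) auto
      then have "runs f g ysel (scan n E P t \<gamma> V b as) ?R (length as * (n * grid_count + 10))"
        by (rule runs_weaken[OF Cons.IH]) simp
      then show ?thesis unfolding None option.case .
    next
      case (Some p)
      then have "Some p \<in> ?R" using r unfolding answers_def by simp
      then show ?thesis unfolding Some option.case by (rule runs_return)
    qed
  qed
  then show ?case by simp
qed

lemma runs_scan_thin:
  assumes "\<exists>d. thin_direction X d"
  shows "runs f g ysel (scan_thin n E P t \<gamma> V X) (answers X) (98 * (n * grid_count + 10))"
proof -
  obtain b a m where bam: "(SOME d. thin_direction X d) = (b, a, m)" by (metis prod.exhaust)
  have "thin_direction X (b, a, m)" using someI_ex[OF assms] unfolding bam .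
  then have unit: "icross b a = 1" and X: "icross b ` X \<subseteq> {m..m + 97}"
    unfolding thin_direction_def by auto
  let ?as = "map (\<lambda>j. multiple j a) [m..m + 97]"
  have "b \<noteq> 0" using unit by (auto simp: icross_def)
  moreover have "X \<subseteq> (\<Union>a\<in>set ?as. {a + multiple l b | l. True})"
  proof
    fix p assume "p \<in> X"
    then have "icross b p \<in> {m..m + 97}" using X by blast
    then show "p \<in> (\<Union>a\<in>set ?as. {a + multiple l b | l. True})"
      using lattice_basis_expansion[OF unit, of p] by auto
  qed
  then have "answers (\<Union>a\<in>set ?as. {a + multiple l b | l. True}) \<subseteq> answers X"
    by (intro answers_mono) blast
  ultimately have "runs f g ysel (scan n E P t \<gamma> V b ?as) (answers X) (98 * (n * grid_count + 10))"
    by (intro runs_weaken[OF runs_scan]) auto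
  then show ?thesis unfolding scan_thin_def bam prod.case .
qed

text \<open>At most one descent in the plane and one scan of 98 lines are performed.\<close>

lemma runs_plane_search:
  "runs f g ysel (plane_search n E P t \<gamma> V) (answers P) (n * grid_count + 98 * (n * grid_count + 10))"
proof (cases "largest_triangle (lattice_point ` P)")
  case None
  have "runs f g ysel (scan_thin n E P t \<gamma> V P) (answers P) (n * grid_count + 98 * (n * grid_count + 10))"
    using runs_scan_thin[OF thin_direction_collinear[OF None]] by (rule runs_weaken) auto
  then show ?thesis unfolding plane_search_def None option.case .
next
  case (Some T)
  let ?H = "\<lambda>x. F x - t"
  let ?C = "lattice_point ` candidates"
  let ?X = "\<lambda>T. {p\<in>P. lattice_point p \<in> near_triangle T}"
  have fin: "finite (lattice_point ` P)" using finite_P by simp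
  obtain a b c where T: "T = (a, b, c)" by (cases T)
  have C: "?C \<subseteq> {q\<in>D. ?H q \<le> 0}" using mem_D by (auto simp: candidates_def)
  \<comment> \<open>The largest triangle even gives coordinate bound 1, and the spread bound
    supplies the initial level.\<close>
  have "localizes D ?H ?C V T"
  proof -
    have abc: "a \<in> lattice_point ` P" "b \<in> lattice_point ` P" "c \<in> lattice_point ` P"
      "cross (b - a) (c - a) \<noteq> 0"
      using largest_triangle_Some(1,2)[OF fin Some] unfolding T by auto
    then have D: "a \<in> D" "b \<in> D" "c \<in> D" by (simp_all add: hull_inc)
    have "\<bar>cross (q - a) (c - a)\<bar> \<le> 2 * \<bar>cross (b - a) (c - a)\<bar> \<and>
        \<bar>cross (b - a) (q - a)\<bar> \<le> 2 * \<bar>cross (b - a) (c - a)\<bar>" if "q \<in> ?C" for q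
      using largest_triangle_coords[OF fin Some[unfolded T], of q] that
      by (fastforce simp: candidates_def)
    then show ?thesis unfolding T localizes_def prod.case
      using abc(4) D F_le[OF D(1)] F_le[OF D(2)] F_le[OF D(3)] by simp
  qed
  note start = runs_descend[OF convex_D _ C _ _ _ this]
  have H: "convex_on D ?H"
    using convex_on_add[OF convex_F, of "\<lambda>_. - t"] convex_D by (simp add: convex_on_const)
  let ?c = "\<lambda>r k. case r of None \<Rightarrow> k None | Some T' \<Rightarrow>
             if \<exists>p. lattice_point p \<in> solid_triangle T'
             then k (Some (SOME p. lattice_point p \<in> solid_triangle T'))
             else scan_thin n E P t \<gamma> V (?X T') k"
  have "runs f g ysel (\<lambda>k. descend n E D t \<gamma> V T (\<lambda>r. ?c r k)) (answers P)
    (n * grid_count + 98 * (n * grid_count + 10))"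
  proof (rule runs_bind[OF start])
    fix r assume r: "r \<in> {r. case r of None \<Rightarrow> ?C = {} | Some T' \<Rightarrow> localizes D ?H ?C (level \<gamma> n V) T'}"
    show "runs f g ysel (?c r) (answers P) (98 * (n * grid_count + 10))"
    proof (cases r)
      case None
      then have "None \<in> answers P" using r by (simp add: answers_def)
      then show ?thesis unfolding None option.case by (rule runs_return)
    next
      case (Some T')
      obtain a b c where T': "T' = (a, b, c)" by (cases T')
      have loc: "localizes D ?H ?C (3 * \<gamma>) (a, b, c)"
        using r level_le localizes_mono unfolding Some T' by (simp only: mem_Collect_eq option.case)
      then have abc: "a \<in> D" "b \<in> D" "c \<in> D" "?H a \<le> 3 * \<gamma>" "?H b \<le> 3 * \<gamma>" "?H c \<le> 3 * \<gamma>"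
        and nondeg: "cross (b - a) (c - a) \<noteq> 0" and near: "?C \<subseteq> near_triangle (a, b, c)"
        unfolding localizes_def by auto
      show ?thesis
      proof (cases "\<exists>p. lattice_point p \<in> solid_triangle T'")
        case True
        define p where "p = (SOME p. lattice_point p \<in> solid_triangle T')"
        have "lattice_point p \<in> solid_triangle T'" unfolding p_def by (rule someI_ex[OF True])
        then obtain s r where sr: "lattice_point p = a + s *\<^sub>R (b - a) + r *\<^sub>R (c - a)"
          "0 \<le> s" "0 \<le> r" "s + r \<le> 1"
          unfolding T' by auto
        have "lattice_point p \<in> D" "?H (lattice_point p) \<le> 3 * \<gamma>"
          unfolding sr(1) using convex_on_triangle_le[OF convex_D H abc sr(2-4)] by blast+
        then have "p \<in> good" by (intro goodI) simp_all
        then have "runs f g ysel (\<lambda>k. k (Some p)) (answers P) (98 * (n * grid_count + 10))"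
          by (intro runs_return) (simp add: answers_def)
        then show ?thesis unfolding Some option.case p_def by (simp only: True if_True)
      next
        case False
        \<comment> \<open>All candidates lie near the triangle, so a negative answer there is a
          negative answer for \<open>P\<close>.\<close>
        have "answers (?X T') \<subseteq> answers P"
          using near unfolding T' by (intro answers_mono) (auto simp: candidates_def)
        moreover have "\<exists>d. thin_direction (?X T') d"
          using thin_direction_lattice_free[OF nondeg] False unfolding T' by blast
        ultimately have "runs f g ysel (scan_thin n E P t \<gamma> V (?X T')) (answers P) (98 * (n * grid_count + 10))"
          by (intro runs_weaken[OF runs_scan_thin]) auto
        then show ?thesis unfolding Some option.case by (simp only: False if_False)
      qed
    qed
  qed (use H \<gamma>_pos V_pos val_ge val_le in auto)
  then show ?thesis unfolding plane_search_def Some option.case .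
qed

end

section \<open>The improvement oracle\<close>

definition embed :: "point \<Rightarrow> real ^ 2" where
  "embed p = (\<chi> i. if i = 1 then fst p else snd p)"

lemma embed_linear: "embed (u *\<^sub>R p + v *\<^sub>R q) = u *\<^sub>R embed p + v *\<^sub>R embed q"
  by (simp add: embed_def vec_eq_iff)

lemma embed_nth: "embed p $ 1 = fst p" "embed p $ 2 = snd p"
  by (simp_all add: embed_def)

lemma embed_lattice_point_Ints: "embed (lattice_point p) $ i \<in> \<int>"
  by (simp add: embed_def lattice_point_def)

lemma integer_vector_embed:
  assumes "\<And>i. (x :: real ^ 2) $ i \<in> \<int>"
  obtains p where "x = embed (lattice_point p)"
proof -
  obtain a b where "x $ 1 = of_int a" "x $ 2 = of_int b"
    using assms by (meson Ints_cases)
  then have "x = embed (lattice_point (a, b))"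
    by (simp add: vec_eq_iff forall_2 embed_nth lattice_point_def)
  then show ?thesis using that by blast
qed

definition box_points :: "nat \<Rightarrow> (int \<times> int) list" where
  "box_points B = List.product [- int B..int B] [- int B..int B]"

text \<open>Outside the plane search, \<open>f\<close> is evaluated only at the query point. The
  number of box points grows with \<open>B\<close>, but querying \<open>g\<close> there is not
  charged.\<close>

definition improvement_oracle ::
  "nat \<Rightarrow> real \<Rightarrow> real \<Rightarrow> (real ^ 2) \<times> 'y \<Rightarrow> (real ^ 2, 'y) procedure" where
  "improvement_oracle B V \<gamma> z =
     Eval_f z (\<lambda>v. ask_g (map (\<lambda>p. embed (lattice_point p)) (box_points B))
       (\<lambda>G. plane_search (nat \<lceil>log 2 (V / \<gamma>)\<rceil>) embed
          {p\<in>set (box_points B). G (embed (lattice_point p)) \<le> 0} (real_of_ereal v) \<gamma> V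
          (\<lambda>r. case r of None \<Rightarrow> Answer None True
             | Some p \<Rightarrow> Ask_y (embed (lattice_point p))
                 (\<lambda>y. Answer (Some (embed (lattice_point p), y)) False))))"

section \<open>Feasible fibres and real-valued convexity of \<phi>\<close>

context mixed_integer_setting
begin

abbreviation "S \<equiv> feasible_set gs m"

lemma feasible_iff_max_constraint: "z \<in> S \<longleftrightarrow> max_constraint gs m z \<le> 0"
  unfolding feasible_set_def max_constraint_def using m_pos by (subst Max_le_iff) auto

text \<open>Since the minimum over \<open>y\<close> is attained, a nonpositive value of it exhibits
  a feasible \<open>y\<close>.\<close>

lemma g_min_le_0_iff: "g_min gs m x \<le> 0 \<longleftrightarrow> (\<exists>y. (x, y) \<in> S)"
proof -
  obtain y where y: "\<And>y'. max_constraint gs m (x, y) \<le> max_constraint gs m (x, y')"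
    using min_g_attained by blast
  then have "g_min gs m x = max_constraint gs m (x, y)"
    unfolding g_min_def by (intro cInf_eq_minimum) auto
  then show ?thesis unfolding feasible_iff_max_constraint by (metis y order_trans)
qed

lemma convex_feasible: "convex S"
proof (rule convexI)
  fix x y and u v :: real
  assume *: "x \<in> S" "y \<in> S" "0 \<le> u" "0 \<le> v" "u + v = 1"
  have "gs i (u *\<^sub>R x + v *\<^sub>R y) \<le> 0" if i: "i \<in> {1..m}" for i
  proof -
    have "gs i (u *\<^sub>R x + v *\<^sub>R y) \<le> u * gs i x + v * gs i y"
      using gs_convex[OF i] * unfolding convex_on_def by blast
    also have "\<dots> \<le> u * 0 + v * 0"
      using * i unfolding feasible_set_def by (intro add_mono mult_left_mono) auto
    finally show ?thesis by simp
  qed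
  then show "u *\<^sub>R x + v *\<^sub>R y \<in> S" by (simp add: feasible_set_def)
qed

text \<open>The set is the projection of the convex set \<open>S\<close>.\<close>

lemma convex_g_min_le_0: "convex {x. g_min gs m x \<le> 0}"
proof (rule convexI)
  fix x y and u v :: real
  assume *: "x \<in> {x. g_min gs m x \<le> 0}" "y \<in> {x. g_min gs m x \<le> 0}" "0 \<le> u" "0 \<le> v" "u + v = 1"
  then obtain x' y' where "(x, x') \<in> S" "(y, y') \<in> S" unfolding g_min_le_0_iff by blast
  then have "u *\<^sub>R (x, x') + v *\<^sub>R (y, y') \<in> S" using * convexD[OF convex_feasible] by blast
  then show "u *\<^sub>R x + v *\<^sub>R y \<in> {x. g_min gs m x \<le> 0}" unfolding g_min_le_0_iff by auto
qed

lemma phi_le: "(x, y) \<in> S \<Longrightarrow> phi f S x \<le> f (x, y)"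
  unfolding phi_def by (rule INF_lower) simp

lemma f_eq_real: "z \<in> S \<Longrightarrow> f z = ereal (real_of_ereal (f z))"
  using f_nonneg[of z] f_finite[of z] by (cases "f z") auto

lemma phi_eq_real:
  assumes "g_min gs m x \<le> 0"
  shows "phi f S x = ereal (real_of_ereal (phi f S x))"
  using min_phi_attained[OF assms] f_eq_real by metis

text \<open>Over nonempty fibres \<phi> is an attained finite value, so extended-real convexity
  passes to the reals.\<close>

lemma phi_convex_real:
  assumes "g_min gs m x \<le> 0" "g_min gs m y \<le> 0" "0 \<le> u" "0 \<le> v" "u + v = 1"
  shows "real_of_ereal (phi f S (u *\<^sub>R x + v *\<^sub>R y))
    \<le> u * real_of_ereal (phi f S x) + v * real_of_ereal (phi f S y)"
proof -
  have xy: "g_min gs m (u *\<^sub>R x + v *\<^sub>R y) \<le> 0"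
    using convexD[OF convex_g_min_le_0, of x y u v] assms by simp
  have "phi f S (u *\<^sub>R x + v *\<^sub>R y) \<le> ereal u * phi f S x + ereal v * phi f S y"
    using phi_convex assms(3-5) unfolding ereal_convex_def by blast
  then have "ereal (real_of_ereal (phi f S (u *\<^sub>R x + v *\<^sub>R y)))
    \<le> ereal u * ereal (real_of_ereal (phi f S x)) + ereal v * ereal (real_of_ereal (phi f S y))"
    unfolding phi_eq_real[OF xy, symmetric] phi_eq_real[OF assms(1), symmetric]
      phi_eq_real[OF assms(2), symmetric] .
  then show ?thesis by simp
qed

end

text \<open>Makes room for the error \<open>4 * \<gamma>\<close> of the search.\<close>

lemma kappa_ge_4: "4 \<le> kappa"
proof -
  have "2 \<le> sqrt 5" by (intro real_le_rsqrt) simp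
  moreover have "sqrt 5 < 3" by (intro real_less_lsqrt) simp_all
  ultimately show ?thesis unfolding kappa_def lambda0_def by (simp add: field_simps)
qed

text \<open>The square gives a polynomial bound in the logarithm for either sign of it;
  \<open>nat\<close> cuts a negative round count to 0.\<close>

lemma rounds_le:
  fixes \<gamma> V :: real
  assumes "0 < V" "0 < \<gamma>"
  shows "V \<le> \<gamma> * 2 ^ nat \<lceil>log 2 (V / \<gamma>)\<rceil>"
    and "real (nat \<lceil>log 2 (V / \<gamma>)\<rceil>) \<le> 2 + (ln (V / \<gamma>))\<^sup>2"
proof -
  define n where "n = nat \<lceil>log 2 (V / \<gamma>)\<rceil>"
  have pos: "0 < V / \<gamma>" using assms by simp
  have "log 2 (V / \<gamma>) \<le> real n" unfolding n_def by linarith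
  then have "V / \<gamma> \<le> 2 powr real n" using pos by (simp add: log_le_iff)
  then show "V \<le> \<gamma> * 2 ^ nat \<lceil>log 2 (V / \<gamma>)\<rceil>"
    using assms unfolding n_def[symmetric] by (simp add: powr_realpow field_simps)
  define \<tau> where "\<tau> = ln (V / \<gamma>)"
  have "1 / 2 \<le> ln (2::real)" using ln2_ge_two_thirds by simp
  then have "\<bar>log 2 (V / \<gamma>)\<bar> \<le> 2 * \<bar>\<tau>\<bar>"
    using mult_left_mono[of "1/2" "ln 2" "\<bar>\<tau>\<bar>"] unfolding log_def \<tau>_def[symmetric]
    by (simp add: abs_divide field_simps)
  moreover have "real n \<le> \<bar>log 2 (V / \<gamma>)\<bar> + 1" unfolding n_def by linarith
  \<comment> \<open>This is the nonnegativity of the square of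
    \<open>\<bar>\<tau>\<bar> - 1\<close>.\<close>
  moreover have "2 * \<bar>\<tau>\<bar> \<le> 1 + \<tau>\<^sup>2"
    using zero_le_power2[of "\<bar>\<tau>\<bar> - 1"] by (simp add: power2_diff)
  ultimately show "real (nat \<lceil>log 2 (V / \<gamma>)\<rceil>) \<le> 2 + (ln (V / \<gamma>))\<^sup>2"
    unfolding n_def \<tau>_def by linarith
qed

text \<open>The search is instantiated with \<phi> along \<open>embed\<close> and with
  \<open>t\<close> the value at the query point. In the count, 981 = 1 + 98 * 10 and 99 = 1 +
  98.\<close>

lemma improvement_oracle_correct:
  assumes setting: "mixed_integer_setting f gs m B V" and "0 < V" "0 < \<gamma>"
    and ysel: "approx_fibre_minimizer f gs m \<gamma> ysel" and z: "z \<in> feasible_set gs m"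
  shows "improvement_answer f (feasible_set gs m) 0 (kappa * \<gamma>) z
      (outcome f (g_min gs m) ysel (improvement_oracle B V \<gamma> z))"
    and "f_evaluations f (g_min gs m) ysel (improvement_oracle B V \<gamma> z)
      \<le> 981 + 99 * (nat \<lceil>log 2 (V / \<gamma>)\<rceil> * grid_count)"
proof -
  interpret mixed_integer_setting f gs m B V by (rule setting)
  let ?g = "g_min gs m"
  let ?lp = "\<lambda>p. embed (lattice_point p)"
  define t where "t = real_of_ereal (f z)"
  define n where "n = nat \<lceil>log 2 (V / \<gamma>)\<rceil>"
  define P where "P = {p\<in>set (box_points B). ?g (?lp p) \<le> 0}"
  define F where "F p = real_of_ereal (phi f S (embed p))" for p
  have fz: "f z = ereal t" unfolding t_def by (rule f_eq_real[OF z])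
  have y: "(x, ysel x) \<in> S" "f (x, ysel x) - ereal \<gamma> \<le> phi f S x" if "?g x \<le> 0" for x
    using ysel that unfolding approx_fibre_minimizer_def by blast+
  \<comment> \<open>The box assumption ensures that the enumeration misses no integer point with a
    nonempty fibre.\<close>
  have in_P: "p \<in> P" if le0: "?g (?lp p) \<le> 0" for p
  proof -
    obtain y where "(?lp p, y) \<in> S" using le0 unfolding g_min_le_0_iff by blast
    from box[OF this, of 1] box[OF this, of 2]
    have "\<bar>real_of_int (fst p)\<bar> \<le> real B" "\<bar>real_of_int (snd p)\<bar> \<le> real B"
      by (simp_all add: embed_nth lattice_point_def)
    then have "fst p \<in> {- int B..int B}" "snd p \<in> {- int B..int B}"
      unfolding atLeastAtMost_iff by linarith+
    then show ?thesis using le0 unfolding P_def box_points_def by (cases p) auto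
  qed
  have convex: "convex {p. ?g (embed p) \<le> 0}"
    using convexD[OF convex_g_min_le_0] by (intro convexI) (simp add: embed_linear)
  then have hull: "?g (embed x) \<le> 0" if "x \<in> convex hull (lattice_point ` P)" for x
    using hull_minimal[of "lattice_point ` P" "{p. ?g (embed p) \<le> 0}" convex] that
    unfolding P_def by auto
  have F_val: "F x \<le> real_of_ereal (f (embed x, ysel (embed x)))"
      "real_of_ereal (f (embed x, ysel (embed x))) \<le> F x + \<gamma>"
      "F x \<le> t + V" if "?g (embed x) \<le> 0" for x
  proof -
    let ?z = "(embed x, ysel (embed x))"
    have eqs: "f ?z = ereal (real_of_ereal (f ?z))" "phi f S (embed x) = ereal (F x)"
      using f_eq_real[OF y(1)[OF that]] phi_eq_real[OF that] unfolding F_def by blast+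
    have "ereal (F x) \<le> ereal (real_of_ereal (f ?z))"
      using phi_le[OF y(1)[OF that]] eqs by metis
    then show 1: "F x \<le> real_of_ereal (f ?z)" by simp
    have "ereal (real_of_ereal (f ?z)) - ereal \<gamma> \<le> ereal (F x)"
      using y(2)[OF that] eqs by metis
    then show "real_of_ereal (f ?z) \<le> F x + \<gamma>" by simp
    \<comment> \<open>The spread is measured against the query point, which yields the starting
      level \<open>V\<close>.\<close>
    have "ereal (real_of_ereal (f ?z)) - ereal t \<le> ereal V"
      using spread_bound[OF y(1)[OF that] z] eqs fz by metis
    then show "F x \<le> t + V" using 1 by simp
  qed
  have convex_F: "convex_on (convex hull (lattice_point ` P)) F"
  proof (rule convex_onI)
    fix s :: real and x y
    assume "0 < s" "s < 1" "x \<in> convex hull (lattice_point ` P)" "y \<in> convex hull (lattice_point ` P)"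
    then show "F ((1 - s) *\<^sub>R x + s *\<^sub>R y) \<le> (1 - s) * F x + s * F y"
      unfolding F_def embed_linear by (intro phi_convex_real hull) auto
  qed (rule convex_convex_hull)
  interpret noisy_values f ?g ysel embed P F t \<gamma> V n
  proof
    show "finite P" unfolding P_def by simp
    show "p \<in> P" if "lattice_point p \<in> convex hull (lattice_point ` P)" for p
      using in_P hull[OF that] by blast
    show "V \<le> \<gamma> * 2 ^ n" unfolding n_def using rounds_le(1) assms(2,3) by blast
  qed (use convex_F F_val hull assms(2,3) in auto)
  let ?k = "\<lambda>r. case r of None \<Rightarrow> Answer None True
             | Some p \<Rightarrow> Ask_y (?lp p) (\<lambda>y. Answer (Some (?lp p, y)) False)"
  let ?m = "\<lambda>k. ask_g (map ?lp (box_points B)) (\<lambda>G. plane_search n embed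
          {p\<in>set (box_points B). G (?lp p) \<le> 0} t \<gamma> V k)"
  let ?N = "n * grid_count + 98 * (n * grid_count + 10)"
  have "runs f ?g ysel ?m (answers P) (0 + ?N)"
  proof (rule runs_bind[OF runs_ask_g])
    fix G assume "G \<in> {G. \<forall>x\<in>set (map ?lp (box_points B)). G x = ?g x}"
    then have "{p\<in>set (box_points B). G (?lp p) \<le> 0} = P" unfolding P_def by auto
    then show "runs f ?g ysel (plane_search n embed {p\<in>set (box_points B). G (?lp p) \<le> 0} t \<gamma> V) (answers P) ?N"
      using runs_plane_search by simp
  qed
  then obtain r where r: "r \<in> answers P" "outcome f ?g ysel (?m ?k) = outcome f ?g ysel (?k r)"
    "f_evaluations f ?g ysel (?m ?k) \<le> 0 + ?N + f_evaluations f ?g ysel (?k r)"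
    unfolding runs_def by blast
  have alg: "improvement_oracle B V \<gamma> z = Eval_f z (\<lambda>v. ask_g (map ?lp (box_points B))
      (\<lambda>G. plane_search n embed {p\<in>set (box_points B). G (?lp p) \<le> 0} (real_of_ereal v) \<gamma> V ?k))"
    unfolding improvement_oracle_def n_def ..
  have out: "outcome f ?g ysel (improvement_oracle B V \<gamma> z) = outcome f ?g ysel (?k r)"
    unfolding alg outcome.simps t_def[symmetric] by (rule r(2))
  have "f_evaluations f ?g ysel (?k r) = 0" by (simp split: option.splits)
  then have "f_evaluations f ?g ysel (improvement_oracle B V \<gamma> z) \<le> Suc ?N"
    unfolding alg f_evaluations.simps t_def[symmetric] using r(3) by simp
  then show "f_evaluations f ?g ysel (improvement_oracle B V \<gamma> z)
      \<le> 981 + 99 * (nat \<lceil>log 2 (V / \<gamma>)\<rceil> * grid_count)"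
    unfolding n_def by (simp add: mult.commute)
  show "improvement_answer f S 0 (kappa * \<gamma>) z (outcome f ?g ysel (improvement_oracle B V \<gamma> z))"
  proof (cases r)
    case None
    then have none: "candidates \<inter> P = {}" using r(1) unfolding answers_def by simp
    \<comment> \<open>A mixed-integer point as good as the query would make its integer part a
      candidate, because \<phi> lies below \<open>f\<close> on the fibre.\<close>
    have False if z': "z' \<in> S" "z' \<in> mixed_integer_points" "f z' \<le> f z" for z'
    proof -
      obtain x y where xy: "z' = (x, y)" by (cases z')
      then have "x $ i \<in> \<int>" for i using z'(2) unfolding mixed_integer_points_def by blast
      then obtain p where p: "x = ?lp p" using integer_vector_embed by blast
      have le0: "?g (?lp p) \<le> 0" using z'(1) unfolding xy p g_min_le_0_iff by blast
      have "phi f S x \<le> ereal t" using phi_le z'(1,3) fz unfolding xy by (metis order_trans)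
      then have "ereal (F (lattice_point p)) \<le> ereal t"
        using phi_eq_real[OF le0] unfolding F_def p by metis
      then have "p \<in> candidates \<inter> P"
        using in_P[OF le0] unfolding candidates_def by simp
      then show False using none by blast
    qed
    then show ?thesis unfolding out None by (auto simp: improvement_answer_def)
  next
    case (Some p)
    let ?z = "(?lp p, ysel (?lp p))"
    have p: "p \<in> P" "real_of_ereal (f ?z) \<le> t + 4 * \<gamma>"
      using r(1) unfolding Some answers_def good_def by simp_all
    then have z': "?z \<in> S" using y(1) unfolding P_def by blast
    have "4 * \<gamma> \<le> kappa * \<gamma>" using kappa_ge_4 assms(3) by simp
    then have "ereal (real_of_ereal (f ?z)) \<le> ereal (1 + 0) * ereal t + ereal (kappa * \<gamma>)"
      using p(2) by simp
    then have "f ?z \<le> ereal (1 + 0) * f z + ereal (kappa * \<gamma>)"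
      using f_eq_real[OF z'] fz by metis
    moreover have "?z \<in> mixed_integer_points"
      unfolding mixed_integer_points_def by (simp add: embed_lattice_point_Ints)
    ultimately show ?thesis unfolding out Some using z' by (simp add: improvement_answer_def)
  qed
qed

theorem proposition5:
  shows "\<exists>(p :: real poly)
           (alg :: nat \<Rightarrow> real \<Rightarrow> real \<Rightarrow> (real ^ 2) \<times> (real ^ 'd)
                     \<Rightarrow> (real ^ 2, real ^ 'd) procedure).
           \<forall>f gs m B V \<gamma> ysel.
             mixed_integer_setting f gs m B V \<and> 0 < V \<and> 0 < \<gamma> \<and>
             approx_fibre_minimizer f gs m \<gamma> ysel \<longrightarrow>
             (\<forall>z \<in> feasible_set gs m.
                improvement_answer f (feasible_set gs m) 0 (kappa * \<gamma>) z
                  (outcome f (g_min gs m) ysel (alg B V \<gamma> z)) \<and>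
                real (f_evaluations f (g_min gs m) ysel (alg B V \<gamma> z)) \<le> poly p (ln (V / \<gamma>)))"
\<comment> \<open>The polynomial is \<open>981 + 99 * grid_count * (2 + x^2)\<close>. It and the
  algorithm are fixed before the instance is given.\<close>
proof (intro exI[where x = "[:981 + 198 * real grid_count, 0, 99 * real grid_count:]"]
    exI[where x = improvement_oracle] allI impI ballI conjI)
  fix f :: "(real ^ 2) \<times> (real ^ 'd) \<Rightarrow> ereal" and gs m B V \<gamma> ysel z
  assume *: "mixed_integer_setting f gs m B V \<and> 0 < V \<and> 0 < \<gamma> \<and> approx_fibre_minimizer f gs m \<gamma> ysel"
    and z: "z \<in> feasible_set gs m"
  show "improvement_answer f (feasible_set gs m) 0 (kappa * \<gamma>) z
      (outcome f (g_min gs m) ysel (improvement_oracle B V \<gamma> z))"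
    using improvement_oracle_correct(1) * z by blast
  let ?n = "nat \<lceil>log 2 (V / \<gamma>)\<rceil>"
  have "f_evaluations f (g_min gs m) ysel (improvement_oracle B V \<gamma> z) \<le> 981 + 99 * (?n * grid_count)"
    using improvement_oracle_correct(2) * z by blast
  then have "real (f_evaluations f (g_min gs m) ysel (improvement_oracle B V \<gamma> z))
    \<le> real (981 + 99 * (?n * grid_count))"
    by (simp only: of_nat_le_iff)
  also have "\<dots> = 981 + 99 * (real ?n * real grid_count)" by simp
  also have "\<dots> \<le> 981 + 99 * ((2 + (ln (V / \<gamma>))\<^sup>2) * real grid_count)"
    using rounds_le(2)[of V \<gamma>] * by (intro add_left_mono mult_left_mono mult_right_mono) auto
  also have "\<dots> = poly [:981 + 198 * real grid_count, 0, 99 * real grid_count:] (ln (V / \<gamma>))"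
    by (simp add: power2_eq_square algebra_simps)
  finally show "real (f_evaluations f (g_min gs m) ysel (improvement_oracle B V \<gamma> z))
    \<le> poly [:981 + 198 * real grid_count, 0, 99 * real grid_count:] (ln (V / \<gamma>))" .
qed

end
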